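(* Let $\alpha>0$ and let $F$ be a continuous distribution function supported on $[1,\infty)$. Let $(X_i)_{i\ge1}$ be i.i.d. with distribution function $F$. If $\overline{F}=1-F\in \mathrm{RV}_{-\alpha}$, then $\kappa_n^\star\to\infty$ in probability as $n\to\infty$.
   Context: $\overline F\in\mathrm{RV}_{-\alpha}$ means $\lim_{t\to\infty}\overline F(tx)/\overline F(t)=x^{-\alpha}$ for every $x>0$. $X_{1:n}\le\dots\le X_{n:n}$ are the order statistics of $X_1,\dots,X_n$. For $1\le k\le n-1$, $$H_{n,k}=\frac1k\sum_{i=1}^k\log\frac{X_{n-k+i:n}}{X_{n-k:n}},\qquad \widehat\alpha_{n,k}=H_{n,k}^{-1},$$ $$D_{n,k}=\sup_{y\ge1}\Big|\frac1k\sum_{i=1}^k \mathbf 1_{(y,\infty)}\Big(\frac{X_{n-k+i:n}}{X_{n-k:n}}\Big)-y^{-\widehat\alpha_{n,k}}\Big|,$$ and $\kappa_n^\star=\operatorname{argmin}_{1\le k\le n-1}D_{n,k}$ (the smallest minimizer if it is not unique). Convergence $\kappa_n^\star\to\infty$ in probability means $\mathbb P(\kappa_n^\star\le M)\to0$ for every $M$. *)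

theory Defs
  imports "HOL-Probability.Probability"
begin

definition regularly_varying :: "(real \<Rightarrow> real) \<Rightarrow> real \<Rightarrow> bool" where
  "regularly_varying f \<rho> \<longleftrightarrow> (\<forall>x>0. ((\<lambda>t. f (t * x) / f t) \<longlongrightarrow> x powr \<rho>) at_top)"

text \<open>
  The statistics below are functions of a realization \<open>x\<close> of the sequence. The sample
  of size \<open>n\<close> is \<open>x 1, \<dots>, x n\<close> (the value \<open>x 0\<close> is never used), and order statistics
  are numbered from 1 to \<open>n\<close>.
\<close>

definition order_stat :: "(nat \<Rightarrow> real) \<Rightarrow> nat \<Rightarrow> nat \<Rightarrow> real" where
  "order_stat x n i = sort (map x [1..<Suc n]) ! (i - 1)"

definition hill :: "(nat \<Rightarrow> real) \<Rightarrow> nat \<Rightarrow> nat \<Rightarrow> real" where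
  "hill x n k =
    (1 / real k) * (\<Sum>i=1..k. ln (order_stat x n (n - k + i) / order_stat x n (n - k)))"

definition alpha_hat :: "(nat \<Rightarrow> real) \<Rightarrow> nat \<Rightarrow> nat \<Rightarrow> real" where
  "alpha_hat x n k = inverse (hill x n k)"

definition ks_dist :: "(nat \<Rightarrow> real) \<Rightarrow> nat \<Rightarrow> nat \<Rightarrow> real" where
  "ks_dist x n k =
    (SUP y\<in>{1..}. \<bar>(1 / real k) *
        (\<Sum>i=1..k. indicator {y<..} (order_stat x n (n - k + i) / order_stat x n (n - k)))
      - y powr (- alpha_hat x n k)\<bar>)"

text \<open>The value of \<open>kappa_star x n\<close> is meaningful only for \<open>n \<ge> 2\<close>.\<close>

definition kappa_star :: "(nat \<Rightarrow> real) \<Rightarrow> nat \<Rightarrow> nat" where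
  "kappa_star x n = (LEAST k. is_arg_min (ks_dist x n) (\<lambda>j. j \<in> {1..n - 1}) k)"

text \<open>
  Measurability is part of the definition because \<open>measure\<close> is 0 on non-measurable sets,
  so the limit alone could hold vacuously.
\<close>

definition tends_to_infinity_in_prob :: "'a measure \<Rightarrow> (nat \<Rightarrow> 'a \<Rightarrow> nat) \<Rightarrow> bool" where
  "tends_to_infinity_in_prob M K \<longleftrightarrow>
    (\<forall>n. K n \<in> measurable M (count_space UNIV)) \<and>
    (\<forall>m::real. (\<lambda>n. measure M {\<omega> \<in> space M. real (K n \<omega>) \<le> m}) \<longlonglongrightarrow> 0)"

end

theory Submission
  imports Defs "HOL-Real_Asymp.Real_Asymp"
begin

text \<open>
  A step function with a jump of at least \<open>1 / k\<close> cannot be uniformly closer than \<open>1 / (2 * k)\<close>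
  to a continuous function. The empirical survival function of the \<open>k\<close> upper excess ratios
  is such a step function and \<open>y powr (- alpha_hat x n k)\<close> is continuous in \<open>y\<close>, so
  \<open>ks_dist x n k \<ge> 1 / (2 * k)\<close> for every positive sample (\<open>ks_dist_ge\<close>). Hence the minimizer
  exceeds \<open>m\<close> as soon as some \<open>k\<close> has a distance below \<open>1 / (2 * m)\<close>
  (\<open>kappa_star_gt\<close>), and it suffices that the distance at one deterministic sequence
  \<open>k n\<close> becomes small in probability. Any sequence with \<open>k n \<rightarrow> \<infinity>\<close> and \<open>k n / n \<rightarrow> 0\<close> does;
  the proof takes the integer part of \<open>sqrt n\<close>.

  For such a sequence, both the empirical survival function and the Hill estimator are
  controlled by the numbers of exceedances of the levels \<open>u * \<rho> ^ j\<close>, \<open>j = 0, 1, \<dots>\<close>,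
  where \<open>\<rho> > 1\<close> is close to 1 and \<open>u\<close> is a deterministic level slightly below the random
  threshold \<open>T = order_stat x n (n - k)\<close>. Writing \<open>N s\<close> for the number of observations above
  \<open>s\<close>, the logarithm of an excess is, up to an error of a few \<open>ln \<rho>\<close>, equal to \<open>ln \<rho>\<close> times
  the number of levels below it; thus the Hill estimator is close to
  \<open>(ln \<rho> / k) * (\<Sum>j. N (u * \<rho> ^ j))\<close>. If the normalized counts are within a small \<open>\<eta>\<close> of
  \<open>\<rho> powr (- \<alpha> * j)\<close> in the sense of \<open>l\<^sup>1\<close>, then the Hill estimator is close to \<open>1 / \<alpha>\<close>,
  the empirical survival function is uniformly close to \<open>y powr (- \<alpha>)\<close>, and so the distance
  is small (\<open>ks_dist_less_if_close\<close>). The single \<open>l\<^sup>1\<close> bound replaces both a uniform law of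
  large numbers and a separate treatment of the unbounded logarithms.

  The \<open>l\<^sup>1\<close> error is small in mean (\<open>ks_dist_small_in_prob\<close>). The fluctuation of a count around
  its mean is on average at most the square root of the mean; regular variation gives the limit of the
  ratios of the means, and also a geometric bound on them that is uniform in the level
  (\<open>regularly_varying_geometric_bound\<close>), so that Tannery's theorem applies to the sum over \<open>j\<close>.
\<close>

section \<open>Order statistics and exceedance counts\<close>

definition exceedances :: "(nat \<Rightarrow> real) \<Rightarrow> nat \<Rightarrow> real \<Rightarrow> nat" where
  "exceedances x n s = card {i\<in>{1..n}. s < x i}"

definition excess_survival :: "(nat \<Rightarrow> real) \<Rightarrow> nat \<Rightarrow> nat \<Rightarrow> real \<Rightarrow> real" where
  "excess_survival x n k y = (1 / real k) *
     (\<Sum>i=1..k. indicator {y<..} (order_stat x n (n - k + i) / order_stat x n (n - k)))"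

lemma order_stat_mono:
  assumes "1 \<le> i" "i \<le> j" "j \<le> n"
  shows "order_stat x n i \<le> order_stat x n j"
  unfolding order_stat_def by (rule sorted_nth_mono) (use assms in auto)

lemma order_stat_mem:
  assumes "1 \<le> i" "i \<le> n"
  shows "\<exists>j\<in>{1..n}. order_stat x n i = x j"
proof -
  have "order_stat x n i \<in> set (sort (map x [1..<Suc n]))"
    unfolding order_stat_def by (rule nth_mem) (use assms in simp)
  then show ?thesis by (auto simp: less_Suc_eq_le)
qed

text \<open>
  The order statistics are a rearrangement of the sample. All later facts about them come
  from this identity, with indicators or layer counts for \<open>f\<close>.
\<close>

lemma sum_order_stat:
  fixes f :: "real \<Rightarrow> 'b::comm_monoid_add"
  shows "(\<Sum>i=1..n. f (order_stat x n i)) = (\<Sum>i=1..n. f (x i))"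
proof -
  let ?xs = "map x [1..<Suc n]"
  have "(\<Sum>i=1..n. f (order_stat x n i)) = (\<Sum>i<n. f (sort ?xs ! i))"
    unfolding order_stat_def
    by (rule sum.reindex_bij_witness[of _ Suc "\<lambda>i. i - 1"]) (simp_all del: upt_Suc, auto)
  also have "\<dots> = sum_list (map f (sort ?xs))"
    by (simp add: sum_list_sum_nth atLeast0LessThan del: upt_Suc)
  also have "\<dots> = sum_list (map f ?xs)"
    by (metis mset_map mset_sort sum_mset_sum_list)
  also have "\<dots> = (\<Sum>i\<leftarrow>[1..<Suc n]. f (x i))"
    by (simp only: map_map o_def)
  also have "\<dots> = (\<Sum>i=1..n. f (x i))"
    by (simp only: interv_sum_list_conv_sum_set_nat set_upt atLeastLessThanSuc_atLeastAtMost)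
  finally show ?thesis .
qed

lemma exceedances_sum: "of_nat (exceedances x n s) = (\<Sum>i=1..n. if s < x i then 1 else (0::'b::semiring_1))"
  by (simp add: exceedances_def sum.If_cases Int_def)

lemma exceedances_order_stat: "exceedances x n s = card {i\<in>{1..n}. s < order_stat x n i}"
proof -
  have "exceedances x n s = (\<Sum>i=1..n. if s < order_stat x n i then 1 else 0)"
    using sum_order_stat[of "\<lambda>z. if s < z then 1 else (0::nat)" x n] exceedances_sum[of x n s, where 'b=nat]
    by simp
  then show ?thesis
    by (simp add: sum.If_cases Int_def)
qed

lemma exceedances_mono: "s \<le> t \<Longrightarrow> exceedances x n t \<le> exceedances x n s"
  unfolding exceedances_def by (rule card_mono) auto

lemma order_stat_le_iff:
  assumes "1 \<le> i" "i \<le> n"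
  shows "order_stat x n i \<le> s \<longleftrightarrow> exceedances x n s \<le> n - i"
proof
  assume *: "order_stat x n i \<le> s"
  have "{j\<in>{1..n}. s < order_stat x n j} \<subseteq> {i<..n}"
  proof safe
    fix j assume j: "j \<in> {1..n}" "s < order_stat x n j"
    have "\<not> j \<le> i"
      using j * assms order_stat_mono[of j i n x] by auto
    then show "j \<in> {i<..n}"
      using j by simp
  qed
  then have "card {j\<in>{1..n}. s < order_stat x n j} \<le> card {i<..n}"
    by (intro card_mono) auto
  then show "exceedances x n s \<le> n - i"
    by (simp add: exceedances_order_stat)
next
  assume *: "exceedances x n s \<le> n - i"
  show "order_stat x n i \<le> s"
  proof (rule ccontr)
    assume "\<not> order_stat x n i \<le> s"
    then have "{i..n} \<subseteq> {j\<in>{1..n}. s < order_stat x n j}"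
      using order_stat_mono[of i _ n x] assms by (fastforce intro: less_le_trans)
    then have "card {i..n} \<le> card {j\<in>{1..n}. s < order_stat x n j}"
      by (intro card_mono) auto
    with * assms show False
      by (simp add: exceedances_order_stat)
  qed
qed

lemma sum_top_split:
  fixes g :: "real \<Rightarrow> real"
  assumes "k \<le> n"
  shows "(\<Sum>i=1..n. g (x i)) =
    (\<Sum>i=1..n-k. g (order_stat x n i)) + (\<Sum>i=1..k. g (order_stat x n (n - k + i)))"
proof -
  have "(\<Sum>i=1..k. g (order_stat x n (n - k + i))) = (\<Sum>i=n-k+1..n. g (order_stat x n i))"
    by (rule sum.reindex_bij_witness[of _ "\<lambda>i. i - (n - k)" "\<lambda>i. n - k + i"]) (use assms in auto)
  moreover have "(\<Sum>i=1..n. g (order_stat x n i)) =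
    (\<Sum>i=1..n-k. g (order_stat x n i)) + (\<Sum>i=n-k+1..n. g (order_stat x n i))"
    by (subst sum.union_disjoint[symmetric]) (use assms in \<open>auto intro!: sum.cong\<close>)
  ultimately show ?thesis
    using sum_order_stat[of g x n] by linarith
qed

lemma sum_top_le:
  fixes g :: "real \<Rightarrow> real"
  assumes "k \<le> n" "\<And>z. 0 \<le> g z"
  shows "(\<Sum>i=1..k. g (order_stat x n (n - k + i))) \<le> (\<Sum>i=1..n. g (x i))"
  unfolding sum_top_split[OF assms(1)] by (simp add: assms(2) sum_nonneg)

lemma sum_top_eq:
  fixes g :: "real \<Rightarrow> real"
  assumes "1 \<le> k" "k \<le> n - 1" "\<And>z. z \<le> order_stat x n (n - k) \<Longrightarrow> g z = 0"
  shows "(\<Sum>i=1..k. g (order_stat x n (n - k + i))) = (\<Sum>i=1..n. g (x i))"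
proof -
  have "(\<Sum>i=1..n-k. g (order_stat x n i)) = 0"
    by (intro sum.neutral ballI assms(3) order_stat_mono) (use assms in auto)
  then show ?thesis
    using sum_top_split[of k n g x] assms by simp
qed

text \<open>
  Observations not among the upper \<open>k\<close> are at most the threshold and cannot exceed
  \<open>threshold * y\<close>, so the count may run over the whole sample. This removes the ordering
  from the problem: only the threshold itself remains random in a non-additive way.
\<close>

lemma excess_survival_eq:
  assumes "1 \<le> k" "k \<le> n - 1" "0 < order_stat x n (n - k)" "1 \<le> y"
  shows "excess_survival x n k y = real (exceedances x n (order_stat x n (n - k) * y)) / real k"
proof -
  let ?T = "order_stat x n (n - k)"
  have "(\<Sum>i=1..k. indicator {y<..} (order_stat x n (n - k + i) / ?T)) =
     (\<Sum>i=1..k. (if ?T * y < order_stat x n (n - k + i) then 1 else 0) :: real)"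
    using assms(3) by (intro sum.cong) (auto simp: indicator_def field_simps)
  also have "\<dots> = (\<Sum>i=1..n. (if ?T * y < x i then 1 else 0))"
  proof (rule sum_top_eq[of k n x "\<lambda>z. if ?T * y < z then 1 else 0"])
    have "?T \<le> ?T * y" using assms(3,4) by simp
    then show "\<And>z. z \<le> ?T \<Longrightarrow> (if ?T * y < z then 1 else 0) = (0::real)" by auto
  qed (use assms in auto)
  also have "\<dots> = real (exceedances x n (?T * y))"
    using exceedances_sum[of x n "?T * y", where 'b=real] by simp
  finally show ?thesis
    by (simp add: excess_survival_def)
qed

section \<open>The Hill estimator as a sum of exceedance counts\<close>

text \<open>
  Each level \<open>u * \<rho> ^ j\<close> below \<open>z\<close> accounts for one step of length \<open>ln \<rho>\<close> on the way from
  \<open>ln u\<close> to \<open>ln z\<close>. Counting from \<open>j = 0\<close> overestimates \<open>ln (z / u)\<close>.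
\<close>

lemma ln_le_layers:
  fixes u z \<rho> :: real
  assumes "0 < u" "0 < z" "1 < \<rho>" "z \<le> u * \<rho> ^ J"
  shows "ln (z / u) \<le> ln \<rho> * (\<Sum>j<J. if u * \<rho> ^ j < z then 1 else 0)"
  using assms(4)
proof (induction J)
  case 0
  then show ?case using assms by simp
next
  case (Suc J)
  show ?case
  proof (cases "z \<le> u * \<rho> ^ J")
    case True
    then show ?thesis using Suc.IH by simp
  next
    case False
    have "u * \<rho> ^ j < z" if "j \<le> J" for j
    proof -
      have "u * \<rho> ^ j \<le> u * \<rho> ^ J"
        using assms that by (intro mult_left_mono power_increasing) auto
      with False show ?thesis by simp
    qed
    then have "(\<Sum>j<Suc J. if u * \<rho> ^ j < z then 1 else 0) = (\<Sum>j<Suc J. 1::real)"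
      by (intro sum.cong) auto
    moreover have "ln (z / u) \<le> ln (\<rho> ^ Suc J)"
      using Suc.prems assms by (subst ln_le_cancel_iff) (auto simp: field_simps)
    ultimately show ?thesis
      using assms by (simp only: ln_realpow) (simp add: mult.commute)
  qed
qed

text \<open>
  Counting from \<open>j = 1\<close> underestimates it. A level \<open>v\<close> above the threshold \<open>T\<close> only makes the
  left-hand side smaller, and \<open>T \<le> z\<close> covers the case \<open>z < v\<close>, where no level counts.
\<close>

lemma layers_le_ln:
  fixes v z \<rho> T :: real
  assumes "0 < T" "T \<le> v" "T \<le> z" "1 < \<rho>"
  shows "ln \<rho> * (\<Sum>j=1..J. if v * \<rho> ^ j < z then 1 else 0) \<le> ln (z / T)"
proof (induction J)
  case 0
  then show ?case using assms by simp
next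
  case (Suc J)
  show ?case
  proof (cases "v * \<rho> ^ Suc J < z")
    case True
    have "(\<Sum>j=1..Suc J. if v * \<rho> ^ j < z then 1 else 0) \<le> (\<Sum>j=1..Suc J. 1::real)"
      by (intro sum_mono) auto
    then have "ln \<rho> * (\<Sum>j=1..Suc J. if v * \<rho> ^ j < z then 1 else 0) \<le> ln \<rho> * real (Suc J)"
      using assms by (intro mult_left_mono) auto
    also have "\<dots> = ln (\<rho> ^ Suc J)"
      using assms by (simp only: ln_realpow) (simp add: mult.commute)
    also have "\<dots> \<le> ln (z / T)"
    proof -
      have "\<rho> ^ Suc J * T \<le> \<rho> ^ Suc J * v"
        using assms by (intro mult_left_mono) auto
      with True have "\<rho> ^ Suc J * T < z" by (simp add: mult_ac)
      then show ?thesis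
        using assms by (subst ln_le_cancel_iff) (auto simp: field_simps)
    qed
    finally show ?thesis .
  next
    case False
    then show ?thesis using Suc.IH by simp
  qed
qed

lemma sum_layers_eq_exceedances:
  "(\<Sum>i=1..n. \<Sum>j\<in>A. if c j < x i then 1 else 0) = (\<Sum>j\<in>A. real (exceedances x n (c j)))"
  by (subst sum.swap) (simp add: exceedances_sum)

lemma hill_le_layers:
  assumes k: "1 \<le> k" "k \<le> n - 1" and pos: "\<And>i. i \<in> {1..n} \<Longrightarrow> 0 < x i"
    and u: "0 < u" "u \<le> order_stat x n (n - k)" and "1 < \<rho>"
    and top: "\<And>i. i \<in> {1..n} \<Longrightarrow> x i \<le> u * \<rho> ^ J"
  shows "real k * hill x n k \<le> ln \<rho> * (\<Sum>j<J. real (exceedances x n (u * \<rho> ^ j)))"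
proof -
  let ?T = "order_stat x n (n - k)"
  define g where "g = (\<lambda>z. \<Sum>j<J. if u * \<rho> ^ j < z then 1 else (0::real))"
  have "real k * hill x n k = (\<Sum>i=1..k. ln (order_stat x n (n - k + i) / ?T))"
    using k by (simp add: hill_def)
  also have "\<dots> \<le> (\<Sum>i=1..k. ln \<rho> * g (order_stat x n (n - k + i)))"
  proof (rule sum_mono)
    fix i assume i: "i \<in> {1..k}"
    let ?z = "order_stat x n (n - k + i)"
    obtain l where l: "l \<in> {1..n}" "?z = x l"
      using order_stat_mem[of "n - k + i" n x] i k by fastforce
    have z: "0 < ?z" "?z \<le> u * \<rho> ^ J"
      using pos[OF l(1)] top[OF l(1)] l by auto
    have "ln (?z / ?T) \<le> ln (?z / u)"
      using z u by (subst ln_le_cancel_iff) (auto intro!: divide_left_mono divide_pos_pos mult_pos_pos)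
    also have "\<dots> \<le> ln \<rho> * g ?z"
      unfolding g_def by (rule ln_le_layers) (use z u assms in auto)
    finally show "ln (?z / ?T) \<le> ln \<rho> * g ?z" .
  qed
  also have "\<dots> = ln \<rho> * (\<Sum>i=1..k. g (order_stat x n (n - k + i)))"
    by (simp add: sum_distrib_left)
  also have "\<dots> \<le> ln \<rho> * (\<Sum>i=1..n. g (x i))"
    using assms by (intro mult_left_mono sum_top_le) (auto simp: g_def intro!: sum_nonneg)
  also have "(\<Sum>i=1..n. g (x i)) = (\<Sum>j<J. real (exceedances x n (u * \<rho> ^ j)))"
    unfolding g_def by (rule sum_layers_eq_exceedances)
  finally show ?thesis .
qed

lemma layers_le_hill:
  assumes k: "1 \<le> k" "k \<le> n - 1" and T: "0 < order_stat x n (n - k)" "order_stat x n (n - k) \<le> v"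
    and "1 < \<rho>"
  shows "ln \<rho> * (\<Sum>j=1..J. real (exceedances x n (v * \<rho> ^ j))) \<le> real k * hill x n k"
proof -
  let ?T = "order_stat x n (n - k)"
  define g where "g = (\<lambda>z. \<Sum>j=1..J. if v * \<rho> ^ j < z then 1 else (0::real))"
  have "(\<Sum>j=1..J. real (exceedances x n (v * \<rho> ^ j))) = (\<Sum>i=1..n. g (x i))"
    unfolding g_def by (rule sum_layers_eq_exceedances[symmetric])
  also have "\<dots> = (\<Sum>i=1..k. g (order_stat x n (n - k + i)))"
  proof (rule sum_top_eq[symmetric])
    fix z assume "z \<le> ?T"
    moreover have "v \<le> v * \<rho> ^ j" for j
      using assms by (simp add: one_le_power)
    ultimately have "\<not> v * \<rho> ^ j < z" for j
      using T by (meson leD le_less_trans less_le_trans not_le)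
    then show "g z = 0"
      by (simp add: g_def)
  qed (use k in auto)
  finally have "ln \<rho> * (\<Sum>j=1..J. real (exceedances x n (v * \<rho> ^ j))) =
      (\<Sum>i=1..k. ln \<rho> * g (order_stat x n (n - k + i)))"
    by (simp add: sum_distrib_left)
  also have "\<dots> \<le> (\<Sum>i=1..k. ln (order_stat x n (n - k + i) / ?T))"
    unfolding g_def
    by (intro sum_mono layers_le_ln) (use assms in \<open>auto intro!: order_stat_mono\<close>)
  also have "\<dots> = real k * hill x n k"
    using k by (simp add: hill_def)
  finally show ?thesis .
qed

lemma hill_nonneg:
  assumes k: "1 \<le> k" "k \<le> n - 1" and T: "0 < order_stat x n (n - k)"
  shows "0 \<le> hill x n k"
  using layers_le_hill[OF assms order_refl, of 2 0] k by (simp add: zero_le_mult_iff)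

section \<open>The Kolmogorov-Smirnov distance is bounded below\<close>

lemma ks_dist_bdd:
  assumes k: "1 \<le> k" "k \<le> n - 1" and T: "0 < order_stat x n (n - k)"
  shows "bdd_above ((\<lambda>y. \<bar>excess_survival x n k y - y powr (- alpha_hat x n k)\<bar>) ` {1..})"
proof (rule bdd_aboveI2)
  fix y :: real assume y: "y \<in> {1..}"
  have "0 \<le> alpha_hat x n k"
    using hill_nonneg[OF assms] by (simp add: alpha_hat_def)
  then have "y powr (- alpha_hat x n k) \<le> 1" "0 \<le> y powr (- alpha_hat x n k)"
    using y by (auto simp: powr_minus field_simps ge_one_powr_ge_zero)
  moreover have "0 \<le> excess_survival x n k y"
    unfolding excess_survival_def by (intro mult_nonneg_nonneg sum_nonneg) auto
  moreover have "(\<Sum>i=1..k. indicator {y<..} (order_stat x n (n - k + i) / order_stat x n (n - k))) \<le> (\<Sum>i=1..k. 1::real)"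
    by (intro sum_mono) (auto simp: indicator_def)
  then have "excess_survival x n k y \<le> 1"
    using k by (simp add: excess_survival_def field_simps)
  ultimately show "\<bar>excess_survival x n k y - y powr (- alpha_hat x n k)\<bar> \<le> 1"
    by linarith
qed

text \<open>
  At the largest ratio \<open>z\<close> the empirical survival function is 0, while just to the left of
  \<open>z\<close> it is at least \<open>1 / k\<close>. The power function takes nearly the same value at these
  points, so one of the two deviations is at least half of the jump. If \<open>z = 1\<close>, all upper
  observations are tied with the threshold and the deviation at \<open>y = 1\<close> is already 1.
\<close>

lemma ks_dist_ge:
  assumes k: "1 \<le> k" "k \<le> n - 1" and T: "0 < order_stat x n (n - k)"
  shows "1 / (2 * real k) \<le> ks_dist x n k"
proof -
  let ?T = "order_stat x n (n - k)" and ?G = "excess_survival x n k"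
  define a where "a = alpha_hat x n k"
  define z where "z = order_stat x n n / ?T"
  have D: "\<bar>?G y - y powr (- a)\<bar> \<le> ks_dist x n k" if "1 \<le> y" for y
    using cSUP_upper[OF _ ks_dist_bdd[OF assms], of y] that
    by (simp add: ks_dist_def excess_survival_def a_def)
  have "?T \<le> order_stat x n n"
    using k by (intro order_stat_mono) auto
  then have z: "1 \<le> z"
    using T by (simp add: z_def)
  have "exceedances x n (?T * z) \<le> n - n"
    using order_stat_le_iff[of n n x "?T * z"] k T by (simp add: z_def)
  then have G0: "?G z = 0"
    using z k T by (simp add: excess_survival_eq)
  have G1: "1 / real k \<le> ?G y" if "1 \<le> y" "y < z" for y
  proof -
    have "\<not> order_stat x n n \<le> ?T * y"
      using that T by (simp add: z_def field_simps)
    then have "1 \<le> exceedances x n (?T * y)"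
      using order_stat_le_iff[of n n x "?T * y"] k by simp
    then show ?thesis
      using that k T by (simp add: excess_survival_eq divide_right_mono)
  qed
  show ?thesis
  proof (cases "z = 1")
    case True
    have "(1::real) / (2 * real k) \<le> 1"
      using k by (simp add: field_simps)
    with D[of 1] G0 True show ?thesis by simp
  next
    case False
    with z have "1 < z" by simp
    have "1 / real k - z powr (- a) \<le> ks_dist x n k"
    proof (rule tendsto_upperbound)
      show "((\<lambda>y. 1 / real k - y powr (- a)) \<longlongrightarrow> 1 / real k - z powr (- a)) (at_left z)"
        using z by (intro tendsto_intros) auto
      have "eventually (\<lambda>y. y \<in> {1<..<z}) (at_left z)"
        using \<open>1 < z\<close> by (rule eventually_at_left_real)
      then show "eventually (\<lambda>y. 1 / real k - y powr (- a) \<le> ks_dist x n k) (at_left z)"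
      proof eventually_elim
        case (elim y)
        then show ?case
          using D[of y] G1[of y] by (auto simp: abs_le_iff)
      qed
    qed simp
    moreover have "z powr (- a) \<le> ks_dist x n k"
      using D[OF z] G0 by simp
    ultimately show ?thesis
      by (simp add: field_simps)
  qed
qed

text \<open>
  The lower bound \<open>1 / (2 * k)\<close> excludes every \<open>k \<le> m\<close> from minimizing a distance that is
  somewhere below \<open>1 / (2 * m)\<close>.
\<close>

lemma kappa_star_gt:
  assumes pos: "\<And>i. i \<in> {1..n} \<Longrightarrow> 0 < x i"
    and k: "1 \<le> k" "k \<le> n - 1" and D: "ks_dist x n k < 1 / (2 * real m)"
  shows "m < kappa_star x n"
proof -
  let ?P = "is_arg_min (ks_dist x n) (\<lambda>j. j \<in> {1..n - 1})"
  have "\<exists>j. ?P j"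
    using ex_is_arg_min_if_finite[of "{1..n - 1}" "ks_dist x n"] k by force
  then have K: "?P (kappa_star x n)"
    unfolding kappa_star_def by (rule LeastI_ex)
  let ?K = "kappa_star x n"
  have Kn: "1 \<le> ?K" "?K \<le> n - 1"
    using K by (auto simp: is_arg_min_def)
  obtain j where "j \<in> {1..n}" "order_stat x n (n - ?K) = x j"
    using order_stat_mem[of "n - ?K" n x] Kn by force
  with pos have "0 < order_stat x n (n - ?K)" by simp
  then have "1 / (2 * real ?K) \<le> ks_dist x n ?K"
    using Kn by (intro ks_dist_ge)
  also have "\<dots> \<le> ks_dist x n k"
    using K k by (force simp: is_arg_min_def)
  also note D
  finally have *: "1 / (2 * real ?K) < 1 / (2 * real m)" .
  have "m \<noteq> 0"
    using * by (intro notI) simp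
  with * Kn show ?thesis by (simp add: field_simps)
qed

section \<open>The distance is small when the exceedance counts are close to a Pareto tail\<close>

text \<open>
  The map \<open>a \<mapsto> y powr (- a)\<close> is Lipschitz in \<open>ln a\<close>, uniformly in \<open>y\<close>, because
  \<open>t * exp (- t) \<le> 1\<close>. Hence a small relative error of the tail index is a small uniform error
  of the survival function.
\<close>

lemma powr_neg_diff_le:
  fixes a a' c y :: real
  assumes "0 < a" "a \<le> a'" "a' \<le> c * a" "1 \<le> y"
  shows "\<bar>y powr (- a) - y powr (- a')\<bar> \<le> c - 1"
proof -
  define l where "l = ln y"
  have l: "0 \<le> l" using assms by (simp add: l_def)
  have e: "y powr (- t) = exp (- (t * l))" for t
    using assms by (simp add: powr_def l_def)
  have "1 - exp (- ((a' - a) * l)) \<le> (a' - a) * l"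
    using exp_ge_add_one_self[of "- ((a' - a) * l)"] by linarith
  also have "\<dots> \<le> (c - 1) * (a * l)"
    using mult_right_mono[OF assms(3) l] by (simp add: algebra_simps)
  also have "\<dots> \<le> (c - 1) * exp (a * l)"
  proof (rule mult_left_mono)
    show "a * l \<le> exp (a * l)"
      using exp_ge_add_one_self[of "a * l"] by linarith
    have "a * 1 \<le> a * c"
      using order_trans[OF assms(2,3)] by (simp only: mult.commute mult_1_left mult_1_right)
    then show "0 \<le> c - 1"
      using assms(1) mult_le_cancel_left_pos[of a 1 c] by linarith
  qed
  finally have "exp (- (a * l)) * (1 - exp (- ((a' - a) * l))) \<le> exp (- (a * l)) * ((c - 1) * exp (a * l))"
    by (intro mult_left_mono) auto
  also have "\<dots> = c - 1"
    by (simp add: exp_minus)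
  also have "exp (- (a * l)) * (1 - exp (- ((a' - a) * l))) = y powr (- a) - y powr (- a')"
    by (simp add: e right_diff_distrib exp_add[symmetric] algebra_simps)
  finally have "y powr (- a) - y powr (- a') \<le> c - 1" .
  moreover have "y powr (- a') \<le> y powr (- a)"
    using assms by (intro powr_mono) auto
  ultimately show ?thesis by linarith
qed

text \<open>
  With \<open>s = \<alpha> * ln \<rho>\<close>, the Riemann sum \<open>ln \<rho> * (\<Sum>j. exp (- s) ^ j)\<close> for
  \<open>\<integral> y powr (- \<alpha>) / y dy = 1 / \<alpha>\<close> over \<open>y \<ge> 1\<close> is \<open>1 / \<alpha>\<close> times this quotient.
\<close>

lemma geometric_step_bounds:
  fixes s :: real
  assumes "0 < s"
  shows "1 \<le> s / (1 - exp (- s))" "s / (1 - exp (- s)) \<le> exp s"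
proof -
  have p: "0 < 1 - exp (- s)" using assms by simp
  show "1 \<le> s / (1 - exp (- s))"
    using p exp_ge_add_one_self[of "- s"] by (simp add: field_simps)
  have "s \<le> exp s * (1 - exp (- s))"
    using exp_ge_add_one_self[of s] exp_minus_inverse[of s] unfolding right_diff_distrib by linarith
  then show "s / (1 - exp (- s)) \<le> exp s"
    using p by (simp add: field_simps)
qed

text \<open>
  The grid is \<open>u * \<rho> ^ j\<close> with \<open>\<rho> = exp b\<close>, and \<open>s = \<alpha> * b\<close> is the decay of the Pareto tail
  over one step. The level \<open>u\<close> is meant to lie one step below the threshold: the expected
  number of its exceedances is \<open>k * exp s\<close>, hence the normalization. The last two assumptions
  say that the error \<open>\<eta>\<close> is small against one step, so that the threshold is caught between
  \<open>u\<close> and \<open>u * \<rho>\<^sup>2\<close>.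
\<close>

locale geometric_grid =
  fixes x :: "nat \<Rightarrow> real" and n k :: nat and \<alpha> b s u \<eta> :: real
  assumes k: "1 \<le> k" "k \<le> n - 1"
    and pos: "\<And>i. i \<in> {1..n} \<Longrightarrow> 0 < x i"
    and \<alpha>: "0 < \<alpha>" and s: "0 < s" "\<alpha> * b = s"
    and u: "0 < u"
    and close: "\<And>J. (\<Sum>j<J. \<bar>real (exceedances x n (u * exp b ^ j)) / (real k * exp s) - exp (- s) ^ j\<bar>) \<le> \<eta>"
    and \<eta>_upper: "1 < exp s * (1 - \<eta>)" and \<eta>_lower: "exp (- s) + exp s * \<eta> \<le> 1"
begin

abbreviation "N j \<equiv> real (exceedances x n (u * exp b ^ j))"
abbreviation "T \<equiv> order_stat x n (n - k)"

lemma b: "0 < b"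
  using \<alpha> s by (metis zero_less_mult_pos)

lemma N_bounds:
  "real k * (exp s * (exp (- s) ^ j - \<eta>)) \<le> N j" "N j \<le> real k * (exp s * (exp (- s) ^ j + \<eta>))"
proof -
  have "\<bar>N j / (real k * exp s) - exp (- s) ^ j\<bar> \<le> (\<Sum>i<Suc j. \<bar>N i / (real k * exp s) - exp (- s) ^ i\<bar>)"
    by (intro member_le_sum) auto
  also note close
  finally have *: "\<bar>N j / (real k * exp s) - exp (- s) ^ j\<bar> \<le> \<eta>" .
  have p: "0 < real k * exp s" using k by simp
  have "exp (- s) ^ j - \<eta> \<le> N j / (real k * exp s)" "N j / (real k * exp s) \<le> exp (- s) ^ j + \<eta>"
    using * by (auto simp: abs_le_iff)
  then show "real k * (exp s * (exp (- s) ^ j - \<eta>)) \<le> N j" "N j \<le> real k * (exp s * (exp (- s) ^ j + \<eta>))"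
    using p by (simp_all add: pos_le_divide_eq pos_divide_le_eq mult_ac)
qed

lemma threshold_bracket: "u < T" "T \<le> u * exp b ^ 2"
proof -
  have "real k * 1 < real k * (exp s * (1 - \<eta>))"
    using \<eta>_upper k by (intro mult_strict_left_mono) auto
  also have "\<dots> \<le> N 0"
    using N_bounds(1)[of 0] by simp
  finally show "u < T"
    using order_stat_le_iff[of "n - k" n x u] k by (simp add: not_le[symmetric])
  have "N 2 \<le> real k * (exp s * (exp (- s) ^ 2 + \<eta>))"
    by (rule N_bounds)
  also have "exp s * (exp (- s) ^ 2 + \<eta>) = exp (- s) + exp s * \<eta>"
    by (simp add: power2_eq_square distrib_left exp_minus)
  also have "real k * (exp (- s) + exp s * \<eta>) \<le> real k * 1"
    using \<eta>_lower by (intro mult_left_mono) auto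
  finally show "T \<le> u * exp b ^ 2"
    using order_stat_le_iff[of "n - k" n x "u * exp b ^ 2"] k by simp
qed

lemma T_pos: "0 < T"
  using threshold_bracket u by linarith

text \<open>
  The ranges match the layer counts for the logarithms: all levels from \<open>u\<close> on overestimate
  them, and the levels strictly above \<open>u * \<rho>\<^sup>2\<close>, which bounds the threshold from above,
  underestimate them.
\<close>

lemma partial_sum_bounds:
  "(\<Sum>j<J. N j) \<le> real k * exp s * ((\<Sum>j<J. exp (- s) ^ j) + \<eta>)"
  "real k * exp s * ((\<Sum>j=1..J. exp (- s) ^ (j + 2)) - \<eta>) \<le> (\<Sum>j=1..J. N (j + 2))"
proof -
  let ?d = "\<lambda>j. N j / (real k * exp s) - exp (- s) ^ j"
  have p: "0 < real k * exp s" using k by simp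
  have "(\<Sum>j<J. ?d j) \<le> \<eta>"
    by (rule order_trans[OF sum_mono close[of J]]) (rule abs_ge_self)
  then have "(\<Sum>j<J. N j) / (real k * exp s) \<le> (\<Sum>j<J. exp (- s) ^ j) + \<eta>"
    by (simp add: sum_subtractf sum_divide_distrib)
  then show "(\<Sum>j<J. N j) \<le> real k * exp s * ((\<Sum>j<J. exp (- s) ^ j) + \<eta>)"
    using p by (simp only: pos_divide_le_eq mult.commute)
  have "(\<Sum>j=1..J. - ?d (j + 2)) = (\<Sum>j=3..J+2. - ?d j)"
    by (rule sum.reindex_bij_witness[of _ "\<lambda>j. j - 2" "\<lambda>j. j + 2"]) auto
  also have "\<dots> \<le> (\<Sum>j<J+3. \<bar>?d j\<bar>)"
    by (rule order_trans[OF sum_mono[OF abs_ge_minus_self] sum_mono2]) auto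
  also note close
  finally have "(\<Sum>j=1..J. exp (- s) ^ (j + 2)) - (\<Sum>j=1..J. N (j + 2)) / (real k * exp s) \<le> \<eta>"
    by (simp only: minus_diff_eq sum_subtractf sum_divide_distrib)
  then have "(\<Sum>j=1..J. exp (- s) ^ (j + 2)) - \<eta> \<le> (\<Sum>j=1..J. N (j + 2)) / (real k * exp s)"
    by linarith
  then show "real k * exp s * ((\<Sum>j=1..J. exp (- s) ^ (j + 2)) - \<eta>) \<le> (\<Sum>j=1..J. N (j + 2))"
    using p by (simp only: pos_le_divide_eq mult.commute)
qed

text \<open>
  In both Hill bounds the terms of the geometric series and the \<open>l\<^sup>1\<close> error enter separately.
  Replacing the random threshold by \<open>u\<close> or by \<open>u * \<rho>\<^sup>2\<close> shifts the index of the series, which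
  changes the bound only by powers of \<open>exp s\<close>.
\<close>

lemma hill_upper: "\<alpha> * hill x n k \<le> exp (2 * s) + s * exp s * \<eta>"
proof -
  let ?r = "exp (- s)"
  \<comment> \<open>Beyond the sample maximum all counts vanish, so finitely many levels suffice.\<close>
  obtain J where J: "Max (x ` {1..n}) / u < exp b ^ J"
    using real_arch_pow[of "exp b"] b by auto
  have top: "x i \<le> u * exp b ^ J" if "i \<in> {1..n}" for i
  proof -
    have "x i \<le> Max (x ` {1..n})" using that by (intro Max_ge) auto
    with J u show ?thesis by (simp add: pos_divide_less_eq mult.commute)
  qed
  have "real k * (\<alpha> * hill x n k) = \<alpha> * (real k * hill x n k)"
    by simp
  also have "\<dots> \<le> \<alpha> * (ln (exp b) * (\<Sum>j<J. N j))"
    using \<alpha> threshold_bracket b k u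
    by (intro mult_left_mono hill_le_layers pos top) auto
  also have "\<dots> = s * (\<Sum>j<J. N j)"
    using s by simp
  also have "\<dots> \<le> s * (real k * exp s * ((\<Sum>j<J. ?r ^ j) + \<eta>))"
    using s by (intro mult_left_mono partial_sum_bounds) auto
  also have "\<dots> \<le> s * (real k * exp s * (1 / (1 - ?r) + \<eta>))"
  proof -
    have "(\<Sum>j<J. ?r ^ j) \<le> (\<Sum>j. ?r ^ j)"
      using s by (intro sum_le_suminf summable_geometric) auto
    also have "\<dots> = 1 / (1 - ?r)"
      using s by (intro suminf_geometric) auto
    finally show ?thesis
      using s by (intro mult_left_mono add_right_mono) auto
  qed
  also have "\<dots> = real k * (exp s * (s / (1 - ?r)) + s * exp s * \<eta>)"
    by (simp add: field_simps)
  also have "\<dots> \<le> real k * (exp s * exp s + s * exp s * \<eta>)"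
    using geometric_step_bounds[OF s(1)] by (intro mult_left_mono add_right_mono) auto
  finally show ?thesis
    using k by (simp add: exp_double power2_eq_square)
qed

lemma hill_lower: "exp (- (2 * s)) - s * exp s * \<eta> \<le> \<alpha> * hill x n k"
proof -
  let ?r = "exp (- s)"
  have r: "(\<Sum>j=1..J. ?r ^ (j + 2)) = ?r ^ 3 / (1 - ?r) * (1 - ?r ^ J)" for J
  proof -
    have "(\<Sum>j=1..J. ?r ^ (j + 2)) = (\<Sum>j<J. ?r ^ 3 * ?r ^ j)"
      by (rule sum.reindex_bij_witness[of _ Suc "\<lambda>j. j - 1"])
        (auto simp: power_add[symmetric] power_Suc[symmetric] numeral_eq_Suc simp del: power_Suc)
    also have "\<dots> = ?r ^ 3 * ((1 - ?r ^ J) / (1 - ?r))"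
      using s by (subst sum_distrib_left[symmetric], subst sum_gp_strict) auto
    finally show ?thesis by simp
  qed
  have bound: "s * exp s * (?r ^ 3 / (1 - ?r) * (1 - ?r ^ J) - \<eta>) \<le> \<alpha> * hill x n k" for J
  proof -
    have "real k * (s * exp s * (?r ^ 3 / (1 - ?r) * (1 - ?r ^ J) - \<eta>)) =
        s * (real k * exp s * ((\<Sum>j=1..J. ?r ^ (j + 2)) - \<eta>))"
      unfolding r by simp
    also have "\<dots> \<le> s * (\<Sum>j=1..J. N (j + 2))"
      using s by (intro mult_left_mono partial_sum_bounds) auto
    also have "\<dots> = \<alpha> * (ln (exp b) * (\<Sum>j=1..J. real (exceedances x n (u * exp b ^ 2 * exp b ^ j))))"
      unfolding s(2)[symmetric] by (simp add: power_add power2_eq_square mult_ac)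
    also have "\<dots> \<le> \<alpha> * (real k * hill x n k)"
      using \<alpha> threshold_bracket b k T_pos
      by (intro mult_left_mono layers_le_hill) auto
    finally show ?thesis
      using k by (simp add: mult.left_commute)
  qed
  have "s * exp s * (?r ^ 3 / (1 - ?r) * (1 - 0) - \<eta>) \<le> \<alpha> * hill x n k"
  proof (rule LIMSEQ_le_const2)
    show "(\<lambda>J. s * exp s * (?r ^ 3 / (1 - ?r) * (1 - ?r ^ J) - \<eta>)) \<longlonglongrightarrow>
        s * exp s * (?r ^ 3 / (1 - ?r) * (1 - 0) - \<eta>)"
      using s by (intro tendsto_intros LIMSEQ_power_zero) auto
  qed (use bound in blast)
  moreover have "exp s * ?r ^ 3 = exp (- (2 * s))"
    by (simp add: exp_of_nat_mult[symmetric] exp_add[symmetric])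
  then have "s * exp s * (?r ^ 3 / (1 - ?r) * (1 - 0) - \<eta>) =
      exp (- (2 * s)) * (s / (1 - ?r)) - s * exp s * \<eta>"
    by (simp add: right_diff_distrib mult_ac)
  moreover have "exp (- (2 * s)) * 1 \<le> exp (- (2 * s)) * (s / (1 - ?r))"
    using geometric_step_bounds[OF s(1)] by (intro mult_left_mono) auto
  ultimately show ?thesis by linarith
qed

text \<open>
  Both functions are monotone, so comparing them at grid points suffices. Rounding \<open>y\<close> down to the grid and bracketing the threshold costs
  at most three steps in all.
\<close>

lemma excess_survival_close:
  assumes y: "1 \<le> y"
  shows "\<bar>excess_survival x n k y - y powr (- \<alpha>)\<bar> \<le> exp s - exp (- s) + exp s * \<eta>"
proof -
  let ?r = "exp (- s)"
  define j where "j = nat \<lfloor>ln y / b\<rfloor>"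
  have ln_y: "0 \<le> ln y / b" using y b by simp
  have j: "real j * b \<le> ln y" "ln y < (real j + 1) * b"
  proof -
    have *: "real j = of_int \<lfloor>ln y / b\<rfloor>" using ln_y by (simp add: j_def)
    have "real j \<le> ln y / b" unfolding * by simp
    then show "real j * b \<le> ln y" using b by (simp add: pos_le_divide_eq)
    have "ln y / b < real j + 1" unfolding * by linarith
    then show "ln y < (real j + 1) * b" using b by (simp add: pos_divide_less_eq)
  qed
  have "exp (real j * b) \<le> exp (ln y)" "exp (ln y) < exp (real (Suc j) * b)"
    using j by (auto simp: add.commute)
  then have yj: "exp b ^ j \<le> y" "y < exp b ^ Suc j"
    using y by (simp_all only: exp_of_nat_mult exp_ln)
  have "u * exp b ^ j \<le> T * y"
    using threshold_bracket yj u y by (intro mult_mono) auto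
  then have up: "real (exceedances x n (T * y)) \<le> N j"
    using exceedances_mono by simp
  have "T * y \<le> u * exp b ^ 2 * exp b ^ Suc j"
    using threshold_bracket yj u y T_pos by (intro mult_mono) auto
  also have "\<dots> = u * exp b ^ (j + 3)"
    by (simp add: power_add power2_eq_square power3_eq_cube)
  finally have lo: "N (j + 3) \<le> real (exceedances x n (T * y))"
    using exceedances_mono by simp
  have G: "excess_survival x n k y = real (exceedances x n (T * y)) / real k"
    using k T_pos y by (rule excess_survival_eq)
  have "real (exceedances x n (T * y)) \<le> real k * (exp s * (?r ^ j + \<eta>))"
    using up N_bounds(2)[of j] by linarith
  then have Gu: "excess_survival x n k y \<le> exp s * (?r ^ j + \<eta>)"
    using k by (simp add: G pos_divide_le_eq mult.commute)
  have "real k * (exp s * (?r ^ (j + 3) - \<eta>)) \<le> real (exceedances x n (T * y))"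
    using lo N_bounds(1)[of "j + 3"] by linarith
  then have Gl: "exp s * (?r ^ (j + 3) - \<eta>) \<le> excess_survival x n k y"
    using k by (simp add: G pos_le_divide_eq mult.commute)
  have "y powr (- \<alpha>) = exp (- (\<alpha> * ln y))"
    using y by (simp add: powr_def)
  moreover have "\<alpha> * ln y \<le> real (Suc j) * s" "real j * s \<le> \<alpha> * ln y"
    using mult_left_mono[of "ln y" "(real j + 1) * b" \<alpha>] mult_left_mono[of "real j * b" "ln y" \<alpha>] j \<alpha>
    by (auto simp: s(2)[symmetric] algebra_simps)
  ultimately have "exp (real (Suc j) * (- s)) \<le> y powr (- \<alpha>)" "y powr (- \<alpha>) \<le> exp (real j * (- s))"
    by auto
  then have p: "?r ^ Suc j \<le> y powr (- \<alpha>)" "y powr (- \<alpha>) \<le> ?r ^ j"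
    by (simp_all only: exp_of_nat_mult)
  have r1: "?r ^ j \<le> 1" "0 < ?r ^ j" "?r < 1"
    using s by (auto intro!: power_le_one)
  have d: "0 \<le> exp s - ?r" using s by simp
  have c1: "?r ^ j * (exp s - ?r) \<le> exp s - ?r"
    using mult_right_mono[OF r1(1) d] by simp
  have c2: "?r * (?r ^ j * (exp s - ?r)) \<le> ?r ^ j * (exp s - ?r)"
    using mult_right_mono[of ?r 1 "?r ^ j * (exp s - ?r)"] r1 d by simp
  have er: "exp s * ?r = 1" by (simp add: exp_minus)
  have "excess_survival x n k y - y powr (- \<alpha>) \<le> exp s * (?r ^ j + \<eta>) - ?r ^ Suc j"
    using Gu p by linarith
  also have "\<dots> = ?r ^ j * (exp s - ?r) + exp s * \<eta>"
    by (simp add: algebra_simps)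
  finally have 1: "excess_survival x n k y - y powr (- \<alpha>) \<le> exp s - ?r + exp s * \<eta>"
    using c1 by linarith
  have "exp s * ?r ^ (j + 3) = (exp s * ?r) * (?r * ?r * ?r ^ j)"
    by (simp add: power_add power3_eq_cube)
  also have "\<dots> = ?r * ?r * ?r ^ j" unfolding er by simp
  finally have e3: "exp s * ?r ^ (j + 3) = ?r * ?r * ?r ^ j" .
  have "y powr (- \<alpha>) - excess_survival x n k y \<le> ?r ^ j - exp s * (?r ^ (j + 3) - \<eta>)"
    using Gl p by linarith
  also have "\<dots> = (exp s * ?r) * ?r ^ j - ?r * ?r * ?r ^ j + exp s * \<eta>"
    unfolding right_diff_distrib e3 er by simp
  also have "\<dots> = ?r * (?r ^ j * (exp s - ?r)) + exp s * \<eta>"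
    by (simp add: algebra_simps)
  finally have 2: "y powr (- \<alpha>) - excess_survival x n k y \<le> exp s - ?r + exp s * \<eta>"
    using c1 c2 by linarith
  from 1 2 show ?thesis by linarith
qed

lemma ks_dist_le:
  assumes c: "exp (2 * s) + s * exp s * \<eta> \<le> c" "1 / c \<le> exp (- (2 * s)) - s * exp s * \<eta>" "1 \<le> c"
  shows "ks_dist x n k \<le> exp s - exp (- s) + exp s * \<eta> + (c - 1)"
proof -
  let ?H = "hill x n k" and ?a = "alpha_hat x n k"
  have H: "\<alpha> * ?H \<le> c" "1 / c \<le> \<alpha> * ?H"
    using hill_upper hill_lower c by auto
  have "0 < 1 / c" using c by simp
  then have "0 < \<alpha> * ?H" using H by linarith
  then have Hpos: "0 < ?H" using \<alpha> by (simp add: zero_less_mult_iff)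
  then have a: "0 < ?a" by (simp add: alpha_hat_def)
  have le: "\<alpha> \<le> c * ?a" "?a \<le> c * \<alpha>"
    using H Hpos c by (auto simp: alpha_hat_def field_simps)
  have "\<bar>excess_survival x n k y - y powr (- ?a)\<bar> \<le> exp s - exp (- s) + exp s * \<eta> + (c - 1)"
    if y: "1 \<le> y" for y
  proof -
    have "\<bar>y powr (- \<alpha>) - y powr (- ?a)\<bar> \<le> c - 1"
    proof (cases "\<alpha> \<le> ?a")
      case True
      then show ?thesis using powr_neg_diff_le[OF \<alpha> True le(2) y] by simp
    next
      case False
      then show ?thesis using powr_neg_diff_le[OF a _ le(1) y] by (simp add: abs_minus_commute)
    qed
    then show ?thesis
      using excess_survival_close[OF y] by linarith
  qed
  then show ?thesis
    unfolding ks_dist_def by (intro cSUP_least) (auto simp: excess_survival_def)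
qed

end

text \<open>
  Choosing \<open>\<eta> = s\<^sup>2\<close> makes the error small against the step \<open>s\<close>, and \<open>exp (3 * s)\<close> dominates the
  relative error of the Hill estimator, \<open>exp (2 * s)\<close> up to lower order. As \<open>s\<close> tends to 0,
  all requirements of the grid hold and the bound of \<open>geometric_grid.ks_dist_le\<close> tends to 0.
\<close>

lemma ks_dist_less_if_close:
  fixes \<alpha> \<epsilon> :: real
  assumes "0 < \<alpha>" "0 < \<epsilon>"
  obtains b \<eta> where "0 < b" "0 < \<eta>"
    "\<And>x n k u. 1 \<le> k \<Longrightarrow> k \<le> n - 1 \<Longrightarrow> (\<And>i. i \<in> {1..n} \<Longrightarrow> 0 < x i) \<Longrightarrow> 0 < u \<Longrightarrow>
      (\<And>J. (\<Sum>j<J. \<bar>real (exceedances x n (u * exp b ^ j)) / (real k * exp (\<alpha> * b)) - exp (- (\<alpha> * b)) ^ j\<bar>) \<le> \<eta>) \<Longrightarrow>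
      ks_dist x n k < \<epsilon>"
proof -
  have "eventually (\<lambda>s::real. 0 < s) (at_right 0)"
    by (simp add: eventually_at_right_less)
  moreover have "eventually (\<lambda>s::real. 1 < exp s * (1 - s\<^sup>2)) (at_right 0)"
    by real_asymp
  moreover have "eventually (\<lambda>s::real. exp (- s) + exp s * s\<^sup>2 \<le> 1) (at_right 0)"
    by real_asymp
  moreover have "eventually (\<lambda>s::real. exp (2 * s) + s * exp s * s\<^sup>2 \<le> exp (3 * s)) (at_right 0)"
    by real_asymp
  moreover have "eventually (\<lambda>s::real. 1 / exp (3 * s) \<le> exp (- (2 * s)) - s * exp s * s\<^sup>2) (at_right 0)"
    by real_asymp
  moreover have "eventually (\<lambda>s::real. exp s - exp (- s) + exp s * s\<^sup>2 + (exp (3 * s) - 1) < \<epsilon>) (at_right 0)"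
  proof (rule order_tendstoD)
    show "((\<lambda>s::real. exp s - exp (- s) + exp s * s\<^sup>2 + (exp (3 * s) - 1)) \<longlongrightarrow> 0) (at_right 0)"
      by real_asymp
  qed fact
  ultimately have "eventually (\<lambda>s::real. 0 < s \<and> 1 < exp s * (1 - s\<^sup>2) \<and> exp (- s) + exp s * s\<^sup>2 \<le> 1 \<and>
      exp (2 * s) + s * exp s * s\<^sup>2 \<le> exp (3 * s) \<and>
      1 / exp (3 * s) \<le> exp (- (2 * s)) - s * exp s * s\<^sup>2 \<and>
      exp s - exp (- s) + exp s * s\<^sup>2 + (exp (3 * s) - 1) < \<epsilon>) (at_right 0)"
    by eventually_elim auto
  then obtain s :: real where s': "0 < s" "1 < exp s * (1 - s\<^sup>2)" "exp (- s) + exp s * s\<^sup>2 \<le> 1"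
      "exp (2 * s) + s * exp s * s\<^sup>2 \<le> exp (3 * s)"
      "1 / exp (3 * s) \<le> exp (- (2 * s)) - s * exp s * s\<^sup>2"
      "exp s - exp (- s) + exp s * s\<^sup>2 + (exp (3 * s) - 1) < \<epsilon>"
    using eventually_happens[of _ "at_right (0::real)"] by (auto simp: trivial_limit_at_right_real)
  have sb: "\<alpha> * (s / \<alpha>) = s" using assms by simp
  show ?thesis
  proof (rule that[of "s / \<alpha>" "s\<^sup>2"])
    fix x :: "nat \<Rightarrow> real" and n k u
    assume "1 \<le> k" "k \<le> n - 1" "\<And>i. i \<in> {1..n} \<Longrightarrow> 0 < x i" "0 < u"
      "\<And>J. (\<Sum>j<J. \<bar>real (exceedances x n (u * exp (s / \<alpha>) ^ j)) / (real k * exp (\<alpha> * (s / \<alpha>))) - exp (- (\<alpha> * (s / \<alpha>))) ^ j\<bar>) \<le> s\<^sup>2"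
    then interpret geometric_grid x n k \<alpha> "s / \<alpha>" s u "s\<^sup>2"
      using s' assms sb by unfold_locales (simp_all only: sb)
    show "ks_dist x n k < \<epsilon>"
      using ks_dist_le[OF s'(4,5)] s'(1,6) by simp
  qed (use s' assms in auto)
qed

section \<open>Measurability\<close>

lemma SUP_real_def: "(SUP i\<in>I. f i) = (LEAST z::real. \<forall>i\<in>I. f i \<le> z)"
  by (simp add: Sup_real_def)

text \<open>
  This holds for unbounded functions as well: the supremum of a set of reals depends on the
  set only through its upper bounds, and these agree for both index sets.
\<close>

lemma SUP_rational_if_right_continuous:
  fixes f :: "real \<Rightarrow> real"
  assumes "\<And>y. a \<le> y \<Longrightarrow> (f \<longlongrightarrow> f y) (at_right y)"
  shows "(SUP y\<in>{a..}. f y) = (SUP y\<in>{a..} \<inter> \<rat>. f y)"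
proof -
  have "(\<forall>y\<in>{a..}. f y \<le> c) \<longleftrightarrow> (\<forall>y\<in>{a..} \<inter> \<rat>. f y \<le> c)" for c
  proof (intro iffI ballI)
    fix y assume *: "\<forall>y\<in>{a..} \<inter> \<rat>. f y \<le> c" and y: "y \<in> {a..}"
    show "f y \<le> c"
    proof (rule ccontr)
      assume "\<not> f y \<le> c"
      then have "eventually (\<lambda>y. c < f y) (at_right y)"
        using assms[of y] y by (intro order_tendstoD) auto
      then obtain d where d: "y < d" "\<And>z. y < z \<Longrightarrow> z < d \<Longrightarrow> c < f z"
        by (auto simp: eventually_at_right_field)
      obtain q where q: "q \<in> \<rat>" "y < q" "q < d"
        using Rats_dense_in_real[OF d(1)] by blast
      then have "f q \<le> c"
        using y by (intro bspec[OF *]) auto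
      with d(2)[of q] q show False by simp
    qed
  qed auto
  then show ?thesis
    by (simp only: SUP_real_def)
qed

text \<open>
  Measurability of the statistics has to be shown on the whole space, including samples with
  observations that are not positive, for which the estimated index can be negative and the
  distance an unbounded supremum. Where the family is unbounded, the supremum is one fixed
  default value, and the set of these points is measurable.
\<close>

lemma borel_measurable_real_SUP:
  fixes f :: "'b \<Rightarrow> 'a \<Rightarrow> real"
  assumes I: "countable I" and f[measurable]: "\<And>i. i \<in> I \<Longrightarrow> f i \<in> borel_measurable M"
  shows "(\<lambda>\<omega>. SUP i\<in>I. f i \<omega>) \<in> borel_measurable M"
proof (cases "I = {}")
  case False
  define bdd where "bdd \<omega> \<longleftrightarrow> (\<exists>c::nat. \<forall>i\<in>I. f i \<omega> \<le> real c)" for \<omega>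
  have [measurable]: "Measurable.pred M bdd"
    unfolding bdd_def using I by measurable
  define g where "g i \<omega> = (if bdd \<omega> then f i \<omega> else 0)" for i \<omega>
  have "(\<lambda>\<omega>. SUP i\<in>I. g i \<omega>) \<in> borel_measurable M"
  proof (rule borel_measurable_cSUP[OF I])
    show "g i \<in> borel_measurable M" if "i \<in> I" for i
      unfolding g_def using that by measurable
    show "bdd_above ((\<lambda>i. g i \<omega>) ` I)" for \<omega>
      by (auto simp: g_def bdd_def intro: bdd_aboveI2)
  qed
  moreover have "(SUP i\<in>I. f i \<omega>) = (if bdd \<omega> then (SUP i\<in>I. g i \<omega>) else (LEAST z. False))" for \<omega>
  proof (cases "bdd \<omega>")
    case True
    then show ?thesis by (simp add: g_def)
  next
    case unbdd: False
    have "(\<forall>i\<in>I. f i \<omega> \<le> z) = False" for z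
      using unbdd unfolding bdd_def by (meson order_trans real_arch_simple)
    then show ?thesis
      using unbdd by (simp only: SUP_real_def if_False)
  qed
  ultimately show ?thesis
    by (simp cong: measurable_cong)
qed simp

lemma tendsto_indicator_greaterThan_at_right:
  fixes r y :: real
  shows "((\<lambda>y. indicator {y<..} r :: real) \<longlongrightarrow> indicator {y<..} r) (at_right y)"
proof (rule tendsto_eventually)
  show "eventually (\<lambda>z. indicator {z<..} r = (indicator {y<..} r :: real)) (at_right y)"
  proof (cases "y < r")
    case True
    then have "eventually (\<lambda>z. z \<in> {y<..<r}) (at_right y)"
      by (rule eventually_at_right_real)
    then show ?thesis by eventually_elim (use True in auto)
  next
    case False
    then have "eventually (\<lambda>z. z > y) (at_right y)"
      by (simp add: eventually_at_right_less)
    then show ?thesis by eventually_elim (use False in auto)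
  qed
qed

text \<open>
  The deviation is right-continuous in \<open>y\<close> because the survival indicator of the open
  half-line \<open>{y<..}\<close> is; a countable supremum is then enough for measurability.
\<close>

lemma ks_dist_rational:
  "ks_dist x n k = (SUP y\<in>{1..} \<inter> \<rat>. \<bar>excess_survival x n k y - y powr (- alpha_hat x n k)\<bar>)"
  unfolding ks_dist_def excess_survival_def
  by (intro SUP_rational_if_right_continuous tendsto_rabs tendsto_diff tendsto_mult tendsto_const
        tendsto_sum tendsto_indicator_greaterThan_at_right tendsto_powr tendsto_ident_at) simp

context
  fixes M :: "'a measure" and X :: "nat \<Rightarrow> 'a \<Rightarrow> real" and n :: nat
  assumes X[measurable]: "\<And>i. i \<in> {1..n} \<Longrightarrow> X i \<in> borel_measurable M"
begin

lemma measurable_exceedances: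
  "(\<lambda>\<omega>. real (exceedances (\<lambda>i. X i \<omega>) n s)) \<in> borel_measurable M"
  unfolding exceedances_sum by measurable

lemma measurable_order_stat:
  assumes "1 \<le> i" "i \<le> n"
  shows "(\<lambda>\<omega>. order_stat (\<lambda>i. X i \<omega>) n i) \<in> borel_measurable M"
proof (rule borel_measurableI_le)
  fix s
  have [measurable]: "(\<lambda>\<omega>. real (exceedances (\<lambda>i. X i \<omega>) n s)) \<in> borel_measurable M"
    by (rule measurable_exceedances)
  have "{\<omega>\<in>space M. order_stat (\<lambda>i. X i \<omega>) n i \<le> s} =
      {\<omega>\<in>space M. real (exceedances (\<lambda>i. X i \<omega>) n s) \<le> real (n - i)}"
    using assms by (simp add: order_stat_le_iff del: of_nat_diff)
  also have "\<dots> \<in> sets M" by measurable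
  finally show "{\<omega>\<in>space M. order_stat (\<lambda>i. X i \<omega>) n i \<le> s} \<in> sets M" .
qed

lemma measurable_ks_dist:
  assumes "k \<in> {1..n - 1}"
  shows "(\<lambda>\<omega>. ks_dist (\<lambda>i. X i \<omega>) n k) \<in> borel_measurable M"
proof -
  have [measurable]: "(\<lambda>\<omega>. order_stat (\<lambda>i. X i \<omega>) n (n - k)) \<in> borel_measurable M"
    using assms by (intro measurable_order_stat) auto
  have [measurable]: "(\<lambda>\<omega>. order_stat (\<lambda>i. X i \<omega>) n (n - k + i)) \<in> borel_measurable M" if "i \<in> {1..k}" for i
    using assms that by (intro measurable_order_stat) auto
  have [measurable]: "(\<lambda>\<omega>. excess_survival (\<lambda>i. X i \<omega>) n k y) \<in> borel_measurable M" for y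
    unfolding excess_survival_def by measurable
  have [measurable]: "(\<lambda>\<omega>. alpha_hat (\<lambda>i. X i \<omega>) n k) \<in> borel_measurable M"
    unfolding alpha_hat_def hill_def by measurable
  show ?thesis
    unfolding ks_dist_rational
    by (rule borel_measurable_real_SUP) (auto intro: countable_rat)
qed

lemma measurable_kappa_star:
  "(\<lambda>\<omega>. kappa_star (\<lambda>i. X i \<omega>) n) \<in> measurable M (count_space UNIV)"
  unfolding kappa_star_def
proof (rule measurable_Least)
  fix k
  note measurable_ks_dist[measurable]
  show "Measurable.pred M (\<lambda>\<omega>. is_arg_min (ks_dist (\<lambda>i. X i \<omega>) n) (\<lambda>j. j \<in> {1..n - 1}) k)"
  proof (cases "k \<in> {1..n - 1}")
    case True
    have "is_arg_min (ks_dist (\<lambda>i. X i \<omega>) n) (\<lambda>j. j \<in> {1..n - 1}) k \<longleftrightarrow>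
        (\<forall>j\<in>{1..n - 1}. \<not> ks_dist (\<lambda>i. X i \<omega>) n j < ks_dist (\<lambda>i. X i \<omega>) n k)" for \<omega>
      using True by (auto simp: is_arg_min_def)
    then show ?thesis
      using True by simp
  next
    case False
    then show ?thesis by (simp add: is_arg_min_def)
  qed
qed

end

section \<open>Exceedance counts of independent observations\<close>

context prob_space
begin

lemma expectation_square_sum_indep:
  fixes W :: "'i \<Rightarrow> 'a \<Rightarrow> real"
  assumes I: "finite I" and ind: "indep_vars (\<lambda>_. borel) W I"
    and int: "\<And>i. i \<in> I \<Longrightarrow> integrable M (W i)" "\<And>i. i \<in> I \<Longrightarrow> integrable M (\<lambda>\<omega>. (W i \<omega>)\<^sup>2)"
    and mean: "\<And>i. i \<in> I \<Longrightarrow> expectation (W i) = 0"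
  shows "integrable M (\<lambda>\<omega>. (\<Sum>i\<in>I. W i \<omega>)\<^sup>2)"
    and "expectation (\<lambda>\<omega>. (\<Sum>i\<in>I. W i \<omega>)\<^sup>2) = (\<Sum>i\<in>I. expectation (\<lambda>\<omega>. (W i \<omega>)\<^sup>2))"
proof -
  have off: "integrable M (\<lambda>\<omega>. W i \<omega> * W j \<omega>)" "expectation (\<lambda>\<omega>. W i \<omega> * W j \<omega>) = 0"
    if "i \<in> I" "j \<in> I" "i \<noteq> j" for i j
  proof -
    have "indep_vars (\<lambda>_. borel) W {i, j}"
      using that by (intro indep_vars_subset[OF ind]) auto
    moreover have "integrable M (W l)" if "l \<in> {i, j}" for l
      using that \<open>i \<in> I\<close> \<open>j \<in> I\<close> int by auto
    ultimately show "integrable M (\<lambda>\<omega>. W i \<omega> * W j \<omega>)" "expectation (\<lambda>\<omega>. W i \<omega> * W j \<omega>) = 0"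
      using indep_vars_integrable[of "{i, j}" W] indep_vars_lebesgue_integral[of "{i, j}" W] that mean
      by auto
  qed
  have prod_int: "integrable M (\<lambda>\<omega>. W i \<omega> * W j \<omega>)" if "i \<in> I" "j \<in> I" for i j
    using off[OF that] int(2)[OF that(1)] by (cases "i = j") (auto simp: power2_eq_square)
  have sq: "(\<Sum>i\<in>I. W i \<omega>)\<^sup>2 = (\<Sum>i\<in>I. \<Sum>j\<in>I. W i \<omega> * W j \<omega>)" for \<omega>
    by (simp add: power2_eq_square sum_product)
  show "integrable M (\<lambda>\<omega>. (\<Sum>i\<in>I. W i \<omega>)\<^sup>2)"
    unfolding sq by (intro Bochner_Integration.integrable_sum prod_int)
  have "expectation (\<lambda>\<omega>. (\<Sum>i\<in>I. W i \<omega>)\<^sup>2) = (\<Sum>i\<in>I. \<Sum>j\<in>I. expectation (\<lambda>\<omega>. W i \<omega> * W j \<omega>))"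
    unfolding sq using prod_int by (simp add: Bochner_Integration.integral_sum)
  also have "\<dots> = (\<Sum>i\<in>I. \<Sum>j\<in>I. if i = j then expectation (\<lambda>\<omega>. (W i \<omega>)\<^sup>2) else 0)"
    using off by (intro sum.cong) (auto simp: power2_eq_square)
  also have "\<dots> = (\<Sum>i\<in>I. expectation (\<lambda>\<omega>. (W i \<omega>)\<^sup>2))"
    using I by simp
  finally show "expectation (\<lambda>\<omega>. (\<Sum>i\<in>I. W i \<omega>)\<^sup>2) = (\<Sum>i\<in>I. expectation (\<lambda>\<omega>. (W i \<omega>)\<^sup>2))" .
qed

lemma expectation_abs_le_sqrt:
  fixes Y :: "'a \<Rightarrow> real"
  assumes "integrable M Y" "integrable M (\<lambda>\<omega>. (Y \<omega>)\<^sup>2)"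
  shows "expectation (\<lambda>\<omega>. \<bar>Y \<omega>\<bar>) \<le> sqrt (expectation (\<lambda>\<omega>. (Y \<omega>)\<^sup>2))"
proof (rule real_le_rsqrt)
  have "0 \<le> variance (\<lambda>\<omega>. \<bar>Y \<omega>\<bar>)"
    by (rule variance_positive)
  also have "\<dots> = expectation (\<lambda>\<omega>. (Y \<omega>)\<^sup>2) - (expectation (\<lambda>\<omega>. \<bar>Y \<omega>\<bar>))\<^sup>2"
    using assms by (subst variance_eq) auto
  finally show "(expectation (\<lambda>\<omega>. \<bar>Y \<omega>\<bar>))\<^sup>2 \<le> expectation (\<lambda>\<omega>. (Y \<omega>)\<^sup>2)"
    by simp
qed

text \<open>
  The count is binomial with variance at most \<open>n * p\<close>; bounding the first absolute moment by
  the standard deviation gives an estimate that can be summed over the levels.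
\<close>

lemma expectation_abs_exceedances_le:
  fixes X :: "nat \<Rightarrow> 'a \<Rightarrow> real"
  assumes ind: "indep_vars (\<lambda>_. borel) X {1..n}"
    and p: "\<And>i. i \<in> {1..n} \<Longrightarrow> prob {\<omega>\<in>space M. s < X i \<omega>} = p"
  shows "integrable M (\<lambda>\<omega>. real (exceedances (\<lambda>i. X i \<omega>) n s))"
    and "expectation (\<lambda>\<omega>. \<bar>real (exceedances (\<lambda>i. X i \<omega>) n s) - real n * p\<bar>) \<le> sqrt (real n * p)"
proof -
  have X[measurable]: "random_variable borel (X i)" if "i \<in> {1..n}" for i
    using ind that by (auto simp: indep_vars_def)
  define W where "W i \<omega> = (if s < X i \<omega> then 1 else 0) - p" for i \<omega>
  have W_ind: "indep_vars (\<lambda>_. borel) W {1..n}"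
    using indep_vars_compose2[OF ind, of "\<lambda>_ z. (if s < z then 1 else 0) - p" "\<lambda>_. borel"]
    by (simp add: W_def[abs_def])
  have ite_int: "integrable M (\<lambda>\<omega>. if s < X i \<omega> then 1 else (0::real))"
    and ite: "expectation (\<lambda>\<omega>. if s < X i \<omega> then 1 else (0::real)) = p" if i: "i \<in> {1..n}" for i
  proof -
    note X[OF i, measurable]
    have *: "(if s < X i \<omega> then 1 else (0::real)) = indicator {\<omega>\<in>space M. s < X i \<omega>} \<omega>" if "\<omega> \<in> space M" for \<omega>
      using that by simp
    show "integrable M (\<lambda>\<omega>. if s < X i \<omega> then 1 else (0::real))"
      by (rule integrable_const_bound[of _ 1]) auto
    have "expectation (\<lambda>\<omega>. if s < X i \<omega> then 1 else (0::real)) =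
        expectation (indicator {\<omega>\<in>space M. s < X i \<omega>})"
      by (intro Bochner_Integration.integral_cong refl *)
    also have "\<dots> = p"
      using p[OF i] by simp
    finally show "expectation (\<lambda>\<omega>. if s < X i \<omega> then 1 else (0::real)) = p" .
  qed
  have sq: "(W i \<omega>)\<^sup>2 = (1 - 2 * p) * (if s < X i \<omega> then 1 else 0) + p\<^sup>2" for i \<omega>
    by (auto simp: W_def power2_eq_square algebra_simps)
  have W_int: "integrable M (W i)" "integrable M (\<lambda>\<omega>. (W i \<omega>)\<^sup>2)" "expectation (W i) = 0"
    "expectation (\<lambda>\<omega>. (W i \<omega>)\<^sup>2) \<le> p" if i: "i \<in> {1..n}" for i
  proof -
    show "integrable M (W i)" "expectation (W i) = 0"
      unfolding W_def[abs_def] using ite_int[OF i] ite[OF i] by (auto simp: prob_space)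
    show "integrable M (\<lambda>\<omega>. (W i \<omega>)\<^sup>2)"
      unfolding sq using ite_int[OF i] by auto
    have "expectation (\<lambda>\<omega>. (W i \<omega>)\<^sup>2) = (1 - 2 * p) * p + p\<^sup>2"
      unfolding sq using ite_int[OF i] ite[OF i] by (simp add: prob_space)
    also have "\<dots> = p - p\<^sup>2"
      by (simp add: power2_eq_square algebra_simps)
    finally show "expectation (\<lambda>\<omega>. (W i \<omega>)\<^sup>2) \<le> p" by simp
  qed
  have N: "real (exceedances (\<lambda>i. X i \<omega>) n s) - real n * p = (\<Sum>i=1..n. W i \<omega>)" for \<omega>
    by (simp add: exceedances_sum W_def sum_subtractf)
  show "integrable M (\<lambda>\<omega>. real (exceedances (\<lambda>i. X i \<omega>) n s))"
    unfolding exceedances_sum by (intro Bochner_Integration.integrable_sum ite_int)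
  note S = expectation_square_sum_indep[OF finite_atLeastAtMost W_ind W_int(1,2,3)]
  have "expectation (\<lambda>\<omega>. \<bar>\<Sum>i=1..n. W i \<omega>\<bar>) \<le> sqrt (expectation (\<lambda>\<omega>. (\<Sum>i=1..n. W i \<omega>)\<^sup>2))"
    using S(1) W_int by (intro expectation_abs_le_sqrt Bochner_Integration.integrable_sum) auto
  also have "\<dots> = sqrt (\<Sum>i=1..n. expectation (\<lambda>\<omega>. (W i \<omega>)\<^sup>2))"
    using S(2) by simp
  also have "\<dots> \<le> sqrt (\<Sum>i=1..n. p)"
    using W_int(4) by (intro real_sqrt_le_mono sum_mono) auto
  finally show "expectation (\<lambda>\<omega>. \<bar>real (exceedances (\<lambda>i. X i \<omega>) n s) - real n * p\<bar>) \<le> sqrt (real n * p)"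
    by (simp add: N)
qed

text \<open>
  Markov's inequality for the series \<open>\<Sum>j. \<bar>Y j\<bar>\<close>, expressed through its partial sums, which
  are finite at every point, and passed to the limit along the increasing events.
\<close>

lemma prob_partial_sums_exceed_le:
  fixes Y :: "nat \<Rightarrow> 'a \<Rightarrow> real"
  assumes int: "\<And>j. integrable M (Y j)" and e: "\<And>j. expectation (\<lambda>\<omega>. \<bar>Y j \<omega>\<bar>) \<le> e j" "summable e"
    and "0 < \<eta>"
  shows "prob {\<omega>\<in>space M. \<exists>J. \<eta> < (\<Sum>j<J. \<bar>Y j \<omega>\<bar>)} \<le> suminf e / \<eta>"
proof -
  note borel_measurable_integrable[OF int, measurable]
  define A where "A J = {\<omega>\<in>space M. \<eta> < (\<Sum>j<J. \<bar>Y j \<omega>\<bar>)}" for J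
  have e0: "0 \<le> e j" for j
    by (rule order_trans[OF _ e(1)]) simp
  have A: "range A \<subseteq> sets M"
    unfolding A_def by auto
  have "incseq A"
  proof (rule incseq_SucI)
    show "A J \<subseteq> A (Suc J)" for J
      unfolding A_def by (auto intro: less_le_trans)
  qed
  have "prob (A J) \<le> suminf e / \<eta>" for J
  proof -
    have Sint: "integrable M (\<lambda>\<omega>. \<Sum>j<J. \<bar>Y j \<omega>\<bar>)"
      using int by auto
    have "prob (A J) \<le> prob {\<omega>\<in>space M. \<eta> \<le> (\<Sum>j<J. \<bar>Y j \<omega>\<bar>)}"
      unfolding A_def by (intro finite_measure_mono) auto
    also have "\<dots> \<le> expectation (\<lambda>\<omega>. \<Sum>j<J. \<bar>Y j \<omega>\<bar>) / \<eta>"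
      using Sint \<open>0 < \<eta>\<close> by (intro integral_Markov_inequality_measure[where A = "{}"]) (auto intro!: sum_nonneg)
    also have "expectation (\<lambda>\<omega>. \<Sum>j<J. \<bar>Y j \<omega>\<bar>) = (\<Sum>j<J. expectation (\<lambda>\<omega>. \<bar>Y j \<omega>\<bar>))"
      using int by (intro Bochner_Integration.integral_sum) auto
    also have "\<dots> \<le> (\<Sum>j<J. e j)"
      by (intro sum_mono e)
    also have "\<dots> \<le> suminf e"
      using e0 by (intro sum_le_suminf e) auto
    finally show ?thesis
      using \<open>0 < \<eta>\<close> by (simp add: divide_right_mono)
  qed
  then have "prob (\<Union>J. A J) \<le> suminf e / \<eta>"
    by (intro LIMSEQ_le_const2[OF finite_Lim_measure_incseq[OF A \<open>incseq A\<close>]]) blast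
  moreover have "(\<Union>J. A J) = {\<omega>\<in>space M. \<exists>J. \<eta> < (\<Sum>j<J. \<bar>Y j \<omega>\<bar>)}"
    by (auto simp: A_def)
  ultimately show ?thesis by simp
qed

end

section \<open>Regularly varying tails\<close>

text \<open>
  Regular variation gives only pointwise limits. Its single instance at \<open>\<rho>\<close> says that one step
  multiplies \<open>f\<close> by at most some \<open>q < 1\<close> beyond a certain point; iterating yields a bound that is
  uniform in the level. This is the part of Potter's bounds that a geometric grid requires.
\<close>

lemma regularly_varying_geometric_bound:
  assumes rv: "regularly_varying f (- \<alpha>)" and "0 < \<alpha>" "1 < \<rho>" and f: "\<And>t. 0 < f t"
  obtains q where "0 < q" "q < 1" "eventually (\<lambda>t. \<forall>j::nat. f (t * \<rho> ^ j) \<le> q ^ j * f t) at_top"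
proof -
  have r: "\<rho> powr (- \<alpha>) < 1"
    using assms by (simp add: powr_less_one)
  define q where "q = (1 + \<rho> powr (- \<alpha>)) / 2"
  have q: "0 < q" "q < 1" "\<rho> powr (- \<alpha>) < q"
    using r by (auto simp: q_def add_pos_nonneg)
  have "((\<lambda>t. f (t * \<rho>) / f t) \<longlongrightarrow> \<rho> powr (- \<alpha>)) at_top"
    using rv assms by (auto simp: regularly_varying_def)
  from order_tendstoD(2)[OF this q(3)]
  obtain t0 where t0: "\<And>t. t0 \<le> t \<Longrightarrow> f (t * \<rho>) / f t < q"
    by (auto simp: eventually_at_top_linorder)
  have "\<forall>j::nat. f (t * \<rho> ^ j) \<le> q ^ j * f t" if t: "max t0 0 \<le> t" for t
  proof
    fix j :: nat
    show "f (t * \<rho> ^ j) \<le> q ^ j * f t"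
    proof (induction j)
      case (Suc j)
      have "t * 1 \<le> t * \<rho> ^ j"
        using t assms by (intro mult_left_mono one_le_power) auto
      then have "f (t * \<rho> ^ j * \<rho>) / f (t * \<rho> ^ j) < q"
        using t by (intro t0) auto
      then have "f (t * \<rho> ^ j * \<rho>) \<le> q * f (t * \<rho> ^ j)"
        using f[of "t * \<rho> ^ j"] by (simp add: pos_divide_less_eq)
      also have "\<dots> \<le> q * (q ^ j * f t)"
        using Suc q by (intro mult_left_mono) auto
      finally show ?case by (simp add: mult_ac)
    qed simp
  qed
  then have "eventually (\<lambda>t. \<forall>j::nat. f (t * \<rho> ^ j) \<le> q ^ j * f t) at_top"
    unfolding eventually_at_top_linorder by blast
  with q that show ?thesis by blast
qed

text \<open>
  The two summands of \<open>e\<close> are the stochastic fluctuation and the bias of the normalized count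
  at the level \<open>u n * \<rho> ^ j\<close>, with \<open>m n\<close> the expected count at \<open>u n\<close>.
\<close>

lemma tail_error_sum_tendsto_0:
  fixes f :: "real \<Rightarrow> real" and u m :: "nat \<Rightarrow> real"
  assumes rv: "regularly_varying f (- \<alpha>)" and "0 < \<alpha>" "1 < \<rho>" and f: "\<And>t. 0 < f t"
    and u: "filterlim u at_top sequentially" and m: "filterlim m at_top sequentially"
  defines "a \<equiv> \<lambda>n j. f (u n * \<rho> ^ j) / f (u n)"
  defines "e \<equiv> \<lambda>n j. sqrt (a n j) / sqrt (m n) + \<bar>a n j - (\<rho> powr (- \<alpha>)) ^ j\<bar>"
  shows "eventually (\<lambda>n. summable (e n)) sequentially" "(\<lambda>n. suminf (e n)) \<longlonglongrightarrow> 0"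
proof -
  let ?r = "\<rho> powr (- \<alpha>)"
  have r: "0 \<le> ?r" "?r < 1"
    using assms by (auto simp: powr_less_one)
  obtain q where q: "0 < q" "q < 1" and qe: "eventually (\<lambda>t. \<forall>j::nat. f (t * \<rho> ^ j) \<le> q ^ j * f t) at_top"
    using regularly_varying_geometric_bound[OF rv assms(2,3) f] by blast
  define B where "B j = sqrt q ^ j + (q ^ j + ?r ^ j)" for j
  have lim: "(\<lambda>n. e n j) \<longlonglongrightarrow> 0" for j
  proof -
    have "((\<lambda>t. f (t * \<rho> ^ j) / f t) \<longlongrightarrow> (\<rho> ^ j) powr (- \<alpha>)) at_top"
      using rv assms by (auto simp: regularly_varying_def)
    moreover have "(\<rho> ^ j) powr (- \<alpha>) = ?r ^ j"
      using assms by (simp add: powr_realpow[symmetric] powr_powr mult.commute)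
    ultimately have a: "(\<lambda>n. a n j) \<longlonglongrightarrow> ?r ^ j"
      unfolding a_def using filterlim_compose[OF _ u, of "\<lambda>t. f (t * \<rho> ^ j) / f t"] by simp
    have "filterlim (\<lambda>n. sqrt (m n)) at_top sequentially"
      by (rule filterlim_compose[OF sqrt_at_top m])
    then have "(\<lambda>n. sqrt (a n j) / sqrt (m n)) \<longlonglongrightarrow> 0"
      using tendsto_real_sqrt[OF a]
      by (rule tendsto_divide_0[OF _ filterlim_at_top_imp_at_infinity, rotated])
    moreover have "(\<lambda>n. \<bar>a n j - ?r ^ j\<bar>) \<longlonglongrightarrow> \<bar>?r ^ j - ?r ^ j\<bar>"
      by (intro tendsto_intros a)
    ultimately show ?thesis
      unfolding e_def using tendsto_add by fastforce
  qed
  have bound: "eventually (\<lambda>n. \<forall>j. norm (e n j) \<le> B j) sequentially"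
  proof -
    have "eventually (\<lambda>n. \<forall>j. f (u n * \<rho> ^ j) \<le> q ^ j * f (u n)) sequentially"
      using eventually_compose_filterlim[OF qe u] .
    moreover have "eventually (\<lambda>n. 1 \<le> m n) sequentially"
      using m by (simp add: filterlim_at_top)
    ultimately show ?thesis
    proof eventually_elim
      case (elim n)
      show ?case
      proof
        fix j
        have a: "0 < a n j" "a n j \<le> q ^ j"
          using f[of "u n"] f[of "u n * \<rho> ^ j"] elim by (auto simp: a_def field_simps)
        have "sqrt (a n j) / sqrt (m n) \<le> sqrt (a n j) / 1"
          using elim a by (intro divide_left_mono) auto
        also have "\<dots> \<le> sqrt (q ^ j)"
          using a by simp
        also have "\<dots> = sqrt q ^ j"
          by (simp add: real_sqrt_power)
        finally have "sqrt (a n j) / sqrt (m n) \<le> sqrt q ^ j" .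
        moreover have "0 \<le> sqrt (a n j) / sqrt (m n)"
          using a elim by simp
        moreover have "\<bar>a n j - ?r ^ j\<bar> \<le> q ^ j + ?r ^ j"
          using a r zero_le_power[OF r(1), of j] by linarith
        ultimately show "norm (e n j) \<le> B j"
          unfolding e_def B_def real_norm_def by linarith
      qed
    qed
  qed
  have B: "summable B"
    unfolding B_def using q r by (intro summable_add summable_geometric) auto
  have "eventually (\<lambda>(j, n). norm (e n j) \<le> B j) (at_top \<times>\<^sub>F sequentially)"
    unfolding eventually_prod_filter
    by (rule exI[of _ "\<lambda>_. True"], rule exI[of _ "\<lambda>n. \<forall>j. norm (e n j) \<le> B j"]) (use bound in auto)
  from tannerys_theorem[OF lim this B] have
    T: "eventually (\<lambda>n. summable (\<lambda>j. norm (e n j))) sequentially" "(\<lambda>n. suminf (e n)) \<longlonglongrightarrow> (\<Sum>j. 0)"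
    by auto
  show "eventually (\<lambda>n. summable (e n)) sequentially"
    using T(1) by eventually_elim (rule summable_norm_cancel)
  show "(\<lambda>n. suminf (e n)) \<longlonglongrightarrow> 0"
    using T(2) by simp
qed

text \<open>
  The levels \<open>u n\<close> are high quantiles; they exist by the intermediate value theorem, and they tend
  to infinity because \<open>f\<close> is bounded away from 0 on every half-line \<open>{..Z}\<close>.
\<close>

lemma antimono_level_at_top:
  fixes f :: "real \<Rightarrow> real" and p :: "nat \<Rightarrow> real"
  assumes f: "continuous_on UNIV f" "antimono f" "\<And>t. 0 < f t" "(f \<longlongrightarrow> 0) at_top" and "f 0 = 1"
    and p: "p \<longlonglongrightarrow> 0" "eventually (\<lambda>n. 0 < p n) sequentially"
  obtains u where "eventually (\<lambda>n. 0 < u n \<and> f (u n) = p n) sequentially" "filterlim u at_top sequentially"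
proof -
  have ex: "\<exists>u>0. f u = z" if z: "0 < z" "z < 1" for z
  proof -
    have "eventually (\<lambda>t. f t < z) at_top"
      using f(4) z by (intro order_tendstoD)
    then have "eventually (\<lambda>t. f t < z \<and> 0 \<le> t) at_top"
      using eventually_ge_at_top[of 0] by eventually_elim auto
    then obtain c where "f c < z" "0 \<le> c"
      using eventually_happens[of _ "at_top :: real filter"] by auto
    then obtain u where "0 \<le> u" "f u = z"
      using IVT2'[of f c z 0] continuous_on_subset[OF f(1)] z \<open>f 0 = 1\<close> by auto
    with z \<open>f 0 = 1\<close> show ?thesis
      by (metis less_irrefl order_le_less)
  qed
  define u where "u n = (SOME u. 0 < u \<and> f u = p n)" for n
  have "eventually (\<lambda>n. p n < 1) sequentially"
    using p(1) by (intro order_tendstoD) auto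
  with p(2) have lev: "eventually (\<lambda>n. 0 < u n \<and> f (u n) = p n) sequentially"
  proof eventually_elim
    case (elim n)
    then show ?case
      unfolding u_def using someI_ex[OF ex[of "p n"]] by simp
  qed
  have "filterlim u at_top sequentially"
    unfolding filterlim_at_top
  proof
    fix Z
    have "eventually (\<lambda>n. p n < f Z) sequentially"
      using p(1) f(3) by (intro order_tendstoD) auto
    with lev show "eventually (\<lambda>n. Z \<le> u n) sequentially"
    proof eventually_elim
      case (elim n)
      then show ?case
        using antimonoD[OF f(2), of "u n" Z] by force
    qed
  qed
  with lev that show ?thesis by blast
qed

text \<open>
  At a zero of \<open>f\<close> the quotient in the definition takes the default value 0, whereas at \<open>x = 1\<close>
  its limit is 1. So \<open>f\<close> has no zeros near infinity, and by monotonicity none at all.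
\<close>

lemma regularly_varying_pos:
  assumes rv: "regularly_varying f \<rho>" and f: "antimono f" "\<And>t. 0 \<le> f t"
  shows "0 < f t"
proof -
  have "((\<lambda>t. f (t * 1) / f t) \<longlongrightarrow> 1 powr \<rho>) at_top"
    by (rule rv[unfolded regularly_varying_def, rule_format, OF zero_less_one])
  then have "eventually (\<lambda>t. 0 < f (t * 1) / f t) at_top"
    by (rule order_tendstoD) simp
  then have "eventually (\<lambda>z. 0 < f (z * 1) / f z \<and> t \<le> z) at_top"
    using eventually_ge_at_top[of t] by eventually_elim simp
  then obtain z where z: "0 < f (z * 1) / f z" "t \<le> z"
    using eventually_happens[of _ "at_top :: real filter"] by auto
  have "f z \<noteq> 0"
    using z(1) by (intro notI) simp
  then have "0 < f z"
    using f(2)[of z] by simp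
  also have "f z \<le> f t"
    using f(1) z(2) by (rule antimonoD)
  finally show ?thesis .
qed

section \<open>The distance along an intermediate sequence\<close>

text \<open>
  The exceptional event \<open>A\<close> is that the \<open>l\<^sup>1\<close> error of the normalized counts exceeds the tolerance.
  The deterministic bound is used outside \<open>A\<close> and Markov's inequality bounds its probability.
\<close>

lemma (in prob_space) ks_dist_small_in_prob:
  fixes X :: "nat \<Rightarrow> 'a \<Rightarrow> real" and k :: "nat \<Rightarrow> nat" and f :: "real \<Rightarrow> real"
  assumes ind: "indep_vars (\<lambda>_. borel) X {1..}"
    and surv: "\<And>i s. 1 \<le> i \<Longrightarrow> prob {\<omega>\<in>space M. s < X i \<omega>} = f s"
    and f: "continuous_on UNIV f" "antimono f" "(f \<longlongrightarrow> 0) at_top" "f 0 = 1"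
    and rv: "regularly_varying f (- \<alpha>)" "0 < \<alpha>"
    and k: "filterlim k at_top sequentially" "(\<lambda>n. real (k n) / real n) \<longlonglongrightarrow> 0"
    and "0 < \<epsilon>"
  obtains B where "B \<longlonglongrightarrow> 0"
    "eventually (\<lambda>n. 1 \<le> k n \<and> k n \<le> n - 1 \<and>
       (\<exists>A. A \<in> events \<and> prob A \<le> B n \<and>
          (\<forall>\<omega>\<in>space M - A. (\<forall>i\<in>{1..n}. 0 < X i \<omega>) \<longrightarrow> ks_dist (\<lambda>i. X i \<omega>) n (k n) < \<epsilon>))) sequentially"
proof -
  have f0: "0 \<le> f t" for t
    using surv[of 1 t] by (metis measure_nonneg order_refl)
  have f_pos: "0 < f t" for t
    using rv(1) f(2) f0 by (rule regularly_varying_pos)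
  obtain b \<eta> where b: "0 < b" and \<eta>: "0 < \<eta>" and close:
    "\<And>x n k u. 1 \<le> k \<Longrightarrow> k \<le> n - 1 \<Longrightarrow> (\<And>i. i \<in> {1..n} \<Longrightarrow> 0 < x i) \<Longrightarrow> 0 < u \<Longrightarrow>
      (\<And>J. (\<Sum>j<J. \<bar>real (exceedances x n (u * exp b ^ j)) / (real k * exp (\<alpha> * b)) - exp (- (\<alpha> * b)) ^ j\<bar>) \<le> \<eta>) \<Longrightarrow>
      ks_dist x n k < \<epsilon>"
    using ks_dist_less_if_close[OF rv(2) \<open>0 < \<epsilon>\<close>] by blast
  have r: "exp b powr (- \<alpha>) = exp (- (\<alpha> * b))"
    by (simp add: powr_def)
  \<comment> \<open>The level \<open>u n\<close> is chosen with exactly \<open>m n\<close> expected exceedances, one grid step below the threshold.\<close>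
  define m where "m n = real (k n) * exp (\<alpha> * b)" for n
  define p where "p n = m n / real n" for n
  have k_real: "filterlim (\<lambda>n. real (k n)) at_top sequentially"
    by (rule filterlim_compose[OF filterlim_real_sequentially k(1)])
  have m: "filterlim m at_top sequentially"
    unfolding m_def by (rule filterlim_at_top_mult_tendsto_pos[OF tendsto_const _ k_real]) simp
  have "p = (\<lambda>n. real (k n) / real n * exp (\<alpha> * b))"
    by (simp add: p_def m_def fun_eq_iff)
  then have p: "p \<longlonglongrightarrow> 0"
    using tendsto_mult_right[OF k(2), of "exp (\<alpha> * b)"] by simp
  have "eventually (\<lambda>n. 1 \<le> k n) sequentially"
    using k(1) by (simp add: filterlim_at_top)
  moreover have "eventually (\<lambda>n. real (k n) / real n < 1) sequentially"
    using k(2) by (intro order_tendstoD) auto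
  ultimately have kn: "eventually (\<lambda>n. 1 \<le> k n \<and> k n \<le> n - 1) sequentially"
    using eventually_gt_at_top[of 0] by eventually_elim (auto simp: field_simps)
  have "eventually (\<lambda>n. 0 < p n) sequentially"
    using kn eventually_gt_at_top[of 0] by eventually_elim (auto simp: p_def m_def)
  with p obtain u where u: "eventually (\<lambda>n. 0 < u n \<and> f (u n) = p n) sequentially"
      "filterlim u at_top sequentially"
    using antimono_level_at_top[OF f(1,2) f_pos f(3,4)] by blast
  define e where "e n j = sqrt (f (u n * exp b ^ j) / f (u n)) / sqrt (m n)
      + \<bar>f (u n * exp b ^ j) / f (u n) - (exp b powr (- \<alpha>)) ^ j\<bar>" for n j
  have e: "eventually (\<lambda>n. summable (e n)) sequentially" "(\<lambda>n. suminf (e n)) \<longlonglongrightarrow> 0"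
    using tail_error_sum_tendsto_0[OF rv _ f_pos u(2) m, of "exp b"] b by (auto simp: e_def[abs_def])
  have "(\<lambda>n. suminf (e n) / \<eta>) \<longlonglongrightarrow> 0"
    using tendsto_divide[OF e(2) tendsto_const, of \<eta>] \<eta> by simp
  moreover have "eventually (\<lambda>n. 1 \<le> k n \<and> k n \<le> n - 1 \<and>
       (\<exists>A. A \<in> events \<and> prob A \<le> suminf (e n) / \<eta> \<and>
          (\<forall>\<omega>\<in>space M - A. (\<forall>i\<in>{1..n}. 0 < X i \<omega>) \<longrightarrow> ks_dist (\<lambda>i. X i \<omega>) n (k n) < \<epsilon>))) sequentially"
    using e(1) u(1) kn
  proof eventually_elim
    case (elim n)
    let ?N = "\<lambda>\<omega> j. real (exceedances (\<lambda>i. X i \<omega>) n (u n * exp b ^ j))"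
    define Y where "Y j \<omega> = ?N \<omega> j / m n - exp (- (\<alpha> * b)) ^ j" for j \<omega>
    have mn: "0 < m n" "0 < real n" using elim by (auto simp: m_def)
    have ind_n: "indep_vars (\<lambda>_. borel) X {1..n}"
      by (rule indep_vars_subset[OF ind]) auto
    have N: "integrable M (\<lambda>\<omega>. ?N \<omega> j)"
      "expectation (\<lambda>\<omega>. \<bar>?N \<omega> j - real n * f (u n * exp b ^ j)\<bar>) \<le> sqrt (real n * f (u n * exp b ^ j))" for j
      using expectation_abs_exceedances_le[OF ind_n surv] by auto
    have Y_int: "integrable M (Y j)" for j
      unfolding Y_def[abs_def] using N(1) by auto
    have Y_e: "expectation (\<lambda>\<omega>. \<bar>Y j \<omega>\<bar>) \<le> e n j" for j
    proof -
      let ?a = "f (u n * exp b ^ j) / f (u n)"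
      have fu: "f (u n) = m n / real n"
        using elim by (simp add: p_def)
      have na: "real n * f (u n * exp b ^ j) = m n * ?a"
        unfolding fu using mn by simp
      have Nint: "integrable M (\<lambda>\<omega>. \<bar>?N \<omega> j - m n * ?a\<bar>)"
        using N(1) by auto
      have "\<bar>Y j \<omega>\<bar> \<le> \<bar>?N \<omega> j - m n * ?a\<bar> / m n + \<bar>?a - exp (- (\<alpha> * b)) ^ j\<bar>" for \<omega>
      proof -
        have "Y j \<omega> = (?N \<omega> j - m n * ?a) / m n + (?a - exp (- (\<alpha> * b)) ^ j)"
          using mn by (simp add: Y_def diff_divide_distrib)
        then show ?thesis
          using abs_triangle_ineq[of "(?N \<omega> j - m n * ?a) / m n"] mn by simp
      qed
      then have "expectation (\<lambda>\<omega>. \<bar>Y j \<omega>\<bar>) \<le>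
          expectation (\<lambda>\<omega>. \<bar>?N \<omega> j - m n * ?a\<bar> / m n + \<bar>?a - exp (- (\<alpha> * b)) ^ j\<bar>)"
        using Y_int Nint by (intro integral_mono) auto
      also have "\<dots> = expectation (\<lambda>\<omega>. \<bar>?N \<omega> j - m n * ?a\<bar>) / m n + \<bar>?a - exp (- (\<alpha> * b)) ^ j\<bar>"
        using Nint by (simp add: prob_space)
      also have "\<dots> \<le> sqrt (m n * ?a) / m n + \<bar>?a - exp (- (\<alpha> * b)) ^ j\<bar>"
        using N(2)[of j] mn unfolding na by (intro add_right_mono divide_right_mono) auto
      also have "sqrt (m n * ?a) / m n = sqrt ?a / sqrt (m n)"
      proof -
        have *: "sqrt (m n * z) / m n = sqrt z * (sqrt (m n) / m n)" for z
          by (simp add: real_sqrt_mult)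
        have "sqrt (m n) / m n = inverse (sqrt (m n))"
          using mn by (simp add: sqrt_divide_self_eq)
        then show ?thesis by (simp only: * divide_inverse[of "sqrt ?a"])
      qed
      finally show ?thesis
        unfolding e_def r .
    qed
    define A where "A = {\<omega>\<in>space M. \<exists>J. \<eta> < (\<Sum>j<J. \<bar>Y j \<omega>\<bar>)}"
    note borel_measurable_integrable[OF Y_int, measurable]
    have "A \<in> events"
      unfolding A_def by measurable
    moreover have "prob A \<le> suminf (e n) / \<eta>"
      unfolding A_def using Y_int Y_e elim \<eta> by (intro prob_partial_sums_exceed_le) auto
    moreover have "ks_dist (\<lambda>i. X i \<omega>) n (k n) < \<epsilon>"
      if "\<omega> \<in> space M - A" "\<forall>i\<in>{1..n}. 0 < X i \<omega>" for \<omega>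
    proof (rule close)
      show "(\<Sum>j<J. \<bar>?N \<omega> j / (real (k n) * exp (\<alpha> * b)) - exp (- (\<alpha> * b)) ^ j\<bar>) \<le> \<eta>" for J
        using that(1) by (auto simp: A_def Y_def m_def not_less)
    qed (use elim that(2) in auto)
    ultimately show ?case
      using elim by blast
  qed
  ultimately show ?thesis by (rule that)
qed

theorem theorem2p4:
  fixes M :: "'a measure" and X :: "nat \<Rightarrow> 'a \<Rightarrow> real"
    and F :: "real \<Rightarrow> real" and \<alpha> :: real
  assumes "prob_space M"
    and "\<alpha> > 0"
    and "continuous_on UNIV F"
    and "\<And>x. x < 1 \<Longrightarrow> F x = 0"
    and "prob_space.indep_vars M (\<lambda>_. borel) X {1..}"
    and "\<And>i. i \<ge> 1 \<Longrightarrow> cdf (distr M borel (X i)) = F"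
    and "regularly_varying (\<lambda>x. 1 - F x) (- \<alpha>)"
  shows "tends_to_infinity_in_prob M (\<lambda>n \<omega>. kappa_star (\<lambda>i. X i \<omega>) n)"
proof -
  interpret prob_space M by fact
  have X: "random_variable borel (X i)" if "1 \<le> i" for i
    using assms(5) that by (auto simp: indep_vars_def)
  interpret D: real_distribution "distr M borel (X 1)"
    by (rule real_distribution_distr) (simp add: X)
  have F: "F = cdf (distr M borel (X 1))"
    using assms(6)[of 1] by simp
  have le: "prob {\<omega>\<in>space M. X i \<omega> \<le> s} = F s" if "1 \<le> i" for i s
  proof -
    have "F s = measure (distr M borel (X i)) {..s}"
      using assms(6)[OF that] by (auto simp: cdf_def)
    also have "\<dots> = prob (X i -` {..s} \<inter> space M)"
      using X[OF that] by (rule measure_distr) simp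
    also have "X i -` {..s} \<inter> space M = {\<omega>\<in>space M. X i \<omega> \<le> s}"
      by auto
    finally show ?thesis by simp
  qed
  define f where "f s = 1 - F s" for s
  have surv: "prob {\<omega>\<in>space M. s < X i \<omega>} = f s" if "1 \<le> i" for i s
  proof -
    note X[OF that, measurable]
    have "{\<omega>\<in>space M. s < X i \<omega>} = space M - {\<omega>\<in>space M. X i \<omega> \<le> s}"
      by auto
    moreover have "{\<omega>\<in>space M. X i \<omega> \<le> s} \<in> events" by measurable
    ultimately show ?thesis
      using le[OF that] by (simp add: prob_compl f_def)
  qed
  have f: "continuous_on UNIV f" "antimono f" "(f \<longlongrightarrow> 0) at_top" "f 0 = 1"
  proof -
    show "continuous_on UNIV f"
      unfolding f_def by (intro continuous_intros assms)
    show "antimono f"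
      unfolding f_def F by (intro antimonoI diff_left_mono D.cdf_nondecreasing)
    have "((\<lambda>s. 1 - F s) \<longlongrightarrow> 1 - 1) at_top"
      unfolding F by (intro tendsto_intros D.cdf_lim_at_top_prob)
    then show "(f \<longlongrightarrow> 0) at_top" by (simp add: f_def[abs_def])
    show "f 0 = 1" by (simp add: f_def assms(4))
  qed
  have pos: "AE \<omega> in M. \<forall>i\<in>{1..n}. 0 < X i \<omega>" for n
  proof (rule AE_finite_allI)
    fix i assume "i \<in> {1..n}"
    then have i: "1 \<le> i" by simp
    note X[OF i, measurable]
    have "prob {\<omega>\<in>space M. \<not> 0 < X i \<omega>} = 0"
      using le[OF i, of 0] assms(4)[of 0] by (simp add: not_less)
    then show "AE \<omega> in M. 0 < X i \<omega>"
      by (subst AE_iff_measurable[OF _ refl]) (auto simp: emeasure_eq_measure)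
  qed simp
  have K: "(\<lambda>\<omega>. kappa_star (\<lambda>i. X i \<omega>) n) \<in> measurable M (count_space UNIV)" for n
    by (rule measurable_kappa_star) (simp add: X)
  have lim: "(\<lambda>n. prob {\<omega>\<in>space M. real (kappa_star (\<lambda>i. X i \<omega>) n) \<le> c}) \<longlonglongrightarrow> 0" for c
  proof -
    \<comment> \<open>The maximum with 1 keeps the tolerance \<open>1 / (2 * m)\<close> positive when \<open>c \<le> 0\<close>.\<close>
    define m where "m = nat \<lceil>max c 1\<rceil>"
    have m: "0 < m" "c \<le> real m"
      by (simp_all add: m_def) linarith+
    define k where "k n = nat \<lfloor>sqrt (real n)\<rfloor>" for n
    have k: "filterlim k at_top sequentially" "(\<lambda>n. real (k n) / real n) \<longlonglongrightarrow> 0"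
      unfolding k_def by real_asymp+
    have rv: "regularly_varying f (- \<alpha>)"
      using assms(7) by (simp add: f_def[abs_def])
    have eps: "0 < 1 / (2 * real m)" using m by simp
    obtain B where B: "B \<longlonglongrightarrow> 0" and ev: "eventually (\<lambda>n. 1 \<le> k n \<and> k n \<le> n - 1 \<and>
       (\<exists>A. A \<in> events \<and> prob A \<le> B n \<and>
          (\<forall>\<omega>\<in>space M - A. (\<forall>i\<in>{1..n}. 0 < X i \<omega>) \<longrightarrow>
             ks_dist (\<lambda>i. X i \<omega>) n (k n) < 1 / (2 * real m)))) sequentially"
      using ks_dist_small_in_prob[OF assms(5) surv f rv assms(2) k eps] by blast
    from ev have "eventually (\<lambda>n. prob {\<omega>\<in>space M. real (kappa_star (\<lambda>i. X i \<omega>) n) \<le> c} \<le> B n) sequentially"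
    proof eventually_elim
      case (elim n)
      then obtain A where A: "A \<in> events" "prob A \<le> B n" and small:
        "\<And>\<omega>. \<omega> \<in> space M - A \<Longrightarrow> \<forall>i\<in>{1..n}. 0 < X i \<omega> \<Longrightarrow> ks_dist (\<lambda>i. X i \<omega>) n (k n) < 1 / (2 * real m)"
        by blast
      have "AE \<omega> in M. \<omega> \<in> {\<omega>\<in>space M. real (kappa_star (\<lambda>i. X i \<omega>) n) \<le> c} \<longrightarrow> \<omega> \<in> A"
        using pos[of n]
      proof eventually_elim
        case (elim \<omega>)
        show ?case
        proof (intro impI, rule ccontr)
          assume \<omega>: "\<omega> \<in> {\<omega>\<in>space M. real (kappa_star (\<lambda>i. X i \<omega>) n) \<le> c}" "\<omega> \<notin> A"
          have "m < kappa_star (\<lambda>i. X i \<omega>) n"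
            using elim \<omega> \<open>1 \<le> k n \<and> k n \<le> n - 1 \<and> _\<close>
            by (intro kappa_star_gt[OF _ _ _ small]) auto
          with \<omega> m show False by auto
        qed
      qed
      then have "prob {\<omega>\<in>space M. real (kappa_star (\<lambda>i. X i \<omega>) n) \<le> c} \<le> prob A"
        using A(1) by (rule finite_measure_mono_AE)
      with A(2) show ?case by simp
    qed
    then show ?thesis
      using B by (intro tendsto_sandwich[OF _ _ tendsto_const B]) auto
  qed
  show ?thesis
    unfolding tends_to_infinity_in_prob_def using K lim by blast
qed

end
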